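(* Let $0\le k\le n$ and $I\in\mathcal I_k$, and consider the vector $\xi_I$ as an element of $V(z_1)\otimes\cdots\otimes V(z_n)$. Then $$\tilde L_{22}(w,y)\,\xi_I=\prod_{i\in I}\frac{w-z_i}{w-z_i-y}\cdot\xi_I.$$
   Context: **Notation.** $n\ge1$, $[n]=\{1,\dots,n\}$; $\mathcal I_k$ is the set of $k$-element subsets of $[n]$; $\bar I=[n]\setminus I$; $\boldsymbol z=(z_1,\dots,z_n)$; $\lambda,y$ are further variables. $Q_I(\boldsymbol z,y)=\prod_{a\in I,b\in\bar I}(z_a-z_b+y)$. $\mathcal L_{\lambda,y}$: rational functions $f/g$, $f\in\mathbb C[\lambda,y]$, $g$ a finite product of factors $\lambda+ly$, $l\in\mathbb Z$; $\mathcal L_{\lambda,(\boldsymbol z,y)}=\mathcal L_{\lambda,y}\otimes_{\mathbb C[y]}\mathbb C(\boldsymbol z,y)$. $\mathbb C^2$ has basis $v_1,v_2$; $v_I=v_{i_1}\otimes\dots\otimes v_{i_n}$ with $i_j=1$ if $j\in I$, $i_j=2$ otherwise. **Vectors $\xi_I$.** For $i\in I$ put $w(i,I)=\#\{j>i:j\in I\}-\#\{j>i:j\in\bar I\}$ ($j\in[n]$). For $I=\{i_1<\dots<i_k\}$ let $l_I(r,a)=t_r-z_a+y$ if $a<i_r$; $=\lambda+t_r-z_a-w(i_r,I)y$ if $a=i_r$; $=t_r-z_a$ if $a>i_r$. Let $W_I(\lambda,\boldsymbol t,\boldsymbol z,y)=y^k\sum_{\pi\in S_k}\Big(\prod_{r=1}^k\prod_{a=1}^n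 l_I(r,a)\prod_{1\le a<b\le k}\frac{t_a-t_b+y}{t_a-t_b}\Big)\Big|_{t_i\to t_{\pi(i)}}$ and $W_{\sigma,I}(\lambda,\boldsymbol t,\boldsymbol z,y)=W_{\sigma^{-1}(I)}(\lambda,\boldsymbol t,z_{\sigma(1)},\dots,z_{\sigma(n)},y)$. Let $e_k=\prod_{a,b=1}^k(t_a-t_b+y)$, $s_0(i)=n+1-i$, $\tilde W^-_J(\lambda,\boldsymbol t,\boldsymbol z,y)=\frac{(-1)^k}{e_k}W_{s_0,J}(-\lambda-(n-2k)y,\boldsymbol t,\boldsymbol z,y)$. Then $\xi_I=\frac1{Q_I(\boldsymbol z,y)}\sum_{J\in\mathcal I_k}\tilde W^-_J(\lambda,\boldsymbol z_I,\boldsymbol z,y)\,v_J$, where $\boldsymbol z_I$ means that $t_1,\dots,t_k$ are replaced by $\{z_i\}_{i\in I}$. **R-matrix.** In the basis $v_1\otimes v_1,v_1\otimes v_2,v_2\otimes v_1,v_2\otimes v_2$ (columns are images of basis vectors) $$R(\lambda,z,y)=\begin{pmatrix}1&0&0&0\\0&\frac{(\lambda+y)z}{\lambda(z-y)}&-\frac{(\lambda+z)y}{\lambda(z-y)}&0\\0&-\frac{(\lambda-z)y}{\lambda(z-y)}&\frac{(\lambda-y)z}{\lambda(z-y)}&0\\0&0&0&1\end{pmatrix}.$$ $R^{(i,j)}$ acts in the $i$-th and $j$-th tensor factors; $h^{(j)}$ acts on the $j$-th factor by $v_1\mapsto v_1$, $v_2\mapsto-v_2$; an argument $\lambda-y\sum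 h^{(j)}$ means that on a vector on which $\sum h^{(j)}$ acts as $\mu$ one substitutes $\lambda-y\mu$. **Operators.** $V(z_1)\otimes\cdots\otimes V(z_n)$ is the space $(\mathbb C^2)^{\otimes n}\otimes\mathcal L_{\lambda,(\boldsymbol z,y)}$ with the following L-operator. With an auxiliary factor $\mathbb C^2$ numbered $0$, $L(\lambda,w,y)=R^{(0,1)}(\lambda-y\sum_{j=2}^nh^{(j)},w-z_1,y)R^{(0,2)}(\lambda-y\sum_{j=3}^nh^{(j)},w-z_2,y)\cdots R^{(0,n-1)}(\lambda-yh^{(n)},w-z_{n-1},y)R^{(0,n)}(\lambda,w-z_n,y)$, and $L_{ij}(\lambda,w,y)$ is defined by $L(v_j\otimes u)=\sum_iv_i\otimes L_{ij}u$ (expanded in powers of $w^{-1}$ at $w=\infty$). Then $(\tilde L_{22}(w,y)\zeta)(\lambda,\boldsymbol z,y)=L_{22}(\lambda,w,y)\,\zeta(\lambda+y,\boldsymbol z,y)$, the shift $\lambda\mapsto\lambda+y$ being coefficientwise in the basis $v_I$. *)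

theory Defs
  imports
    Complex_Main
    "HOL-Library.Poly_Mapping"
    "HOL-Computational_Algebra.Polynomial"
    "HOL-Computational_Algebra.Fraction_Field"
    "HOL-Computational_Algebra.Formal_Laurent_Series"
    "HOL-Combinatorics.Permutations"
begin

text \<open>
  Vectors in the \<open>n\<close>-fold tensor power of the two-dimensional space are given by their coordinates
  in the basis \<open>v_I\<close>, i.e. as functions \<^typ>\<open>nat set \<Rightarrow> 'a\<close> that vanish outside the subsets of
  \<open>{1..n}\<close>. With an auxiliary factor numbered 0, subsets of \<open>{0..n}\<close> are used: the \<open>j\<close>-th factor
  of \<open>v_I\<close> is \<open>v_1\<close> if \<open>j \<in> I\<close> and \<open>v_2\<close> otherwise.
  The explicit formulas are stated over an arbitrary field and are later instantiated at the
  indeterminates. Indexed variables \<open>z_a\<close>, \<open>t_r\<close> are functions on \<^typ>\<open>nat\<close> of which only the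
  values at \<open>1..n\<close>, respectively \<open>1..k\<close>, matter.
\<close>

definition ksubsets :: "nat \<Rightarrow> nat \<Rightarrow> nat set set" where
  "ksubsets n k = {I. I \<subseteq> {1..n} \<and> card I = k}"

section \<open>Weight functions and the vectors \<open>\<xi>_I\<close>\<close>

definition Q_fun :: "nat \<Rightarrow> nat set \<Rightarrow> (nat \<Rightarrow> 'a::field) \<Rightarrow> 'a \<Rightarrow> 'a" where
  "Q_fun n I z y = (\<Prod>a\<in>I. \<Prod>b\<in>{1..n} - I. z a - z b + y)"

definition w_exp :: "nat \<Rightarrow> nat \<Rightarrow> nat set \<Rightarrow> int" where
  "w_exp n i I = int (card {j\<in>{1..n}. j > i \<and> j \<in> I}) - int (card {j\<in>{1..n}. j > i \<and> j \<notin> I})"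

text \<open>\<open>nth_elem I r\<close> is \<open>i_r\<close> for \<open>I = {i_1 < ... < i_k}\<close> and \<open>1 \<le> r \<le> k\<close>.\<close>

definition nth_elem :: "nat set \<Rightarrow> nat \<Rightarrow> nat" where
  "nth_elem I r = sorted_list_of_set I ! (r - 1)"

definition l_factor ::
  "nat \<Rightarrow> nat set \<Rightarrow> 'a::field \<Rightarrow> (nat \<Rightarrow> 'a) \<Rightarrow> (nat \<Rightarrow> 'a) \<Rightarrow> 'a \<Rightarrow> nat \<Rightarrow> nat \<Rightarrow> 'a" where
  "l_factor n I lam t z y r a =
    (if a < nth_elem I r then t r - z a + y
     else if a = nth_elem I r then lam + t r - z a - of_int (w_exp n a I) * y
     else t r - z a)"

definition W_fun ::
  "nat \<Rightarrow> nat set \<Rightarrow> 'a::field \<Rightarrow> (nat \<Rightarrow> 'a) \<Rightarrow> (nat \<Rightarrow> 'a) \<Rightarrow> 'a \<Rightarrow> 'a" where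
  "W_fun n I lam t z y =
    (let k = card I;
         U = (\<lambda>t. (\<Prod>r\<in>{1..k}. \<Prod>a\<in>{1..n}. l_factor n I lam t z y r a) *
                  (\<Prod>b\<in>{1..k}. \<Prod>a\<in>{1..<b}. (t a - t b + y) / (t a - t b)))
     in y ^ k * (\<Sum>\<pi>\<in>{\<pi>. \<pi> permutes {1..k}}. U (\<lambda>i. t (\<pi> i))))"

text \<open>For a permutation \<open>\<sigma>\<close> of \<open>{1..n}\<close>, the set \<open>\<sigma>\<inverse>(I)\<close> is written as a preimage, so that
  the values of \<open>\<sigma>\<close> outside \<open>{1..n}\<close> are irrelevant.\<close>

definition W_perm_fun ::
  "nat \<Rightarrow> (nat \<Rightarrow> nat) \<Rightarrow> nat set \<Rightarrow> 'a::field \<Rightarrow> (nat \<Rightarrow> 'a) \<Rightarrow> (nat \<Rightarrow> 'a) \<Rightarrow> 'a \<Rightarrow> 'a" where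
  "W_perm_fun n \<sigma> I lam t z y = W_fun n {i\<in>{1..n}. \<sigma> i \<in> I} lam t (\<lambda>i. z (\<sigma> i)) y"

definition e_fun :: "nat \<Rightarrow> (nat \<Rightarrow> 'a::field) \<Rightarrow> 'a \<Rightarrow> 'a" where
  "e_fun k t y = (\<Prod>a\<in>{1..k}. \<Prod>b\<in>{1..k}. t a - t b + y)"

definition W_minus ::
  "nat \<Rightarrow> nat set \<Rightarrow> 'a::field \<Rightarrow> (nat \<Rightarrow> 'a) \<Rightarrow> (nat \<Rightarrow> 'a) \<Rightarrow> 'a \<Rightarrow> 'a" where
  "W_minus n J lam t z y =
    (let k = card J
     in (- 1) ^ k / e_fun k t y *
        W_perm_fun n (\<lambda>i. n + 1 - i) J (- lam - of_int (int n - 2 * int k) * y) t z y)"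

text \<open>\<open>W_minus\<close> is symmetric in \<open>t_1, ..., t_k\<close>; we substitute the \<open>z_i\<close>, \<open>i \<in> I\<close>, in increasing
  order of \<open>i\<close>.\<close>

definition xi_fun ::
  "nat \<Rightarrow> nat set \<Rightarrow> 'a::field \<Rightarrow> (nat \<Rightarrow> 'a) \<Rightarrow> 'a \<Rightarrow> nat set \<Rightarrow> 'a" where
  "xi_fun n I lam z y J =
    (if J \<in> ksubsets n (card I)
     then 1 / Q_fun n I z y * W_minus n J lam (\<lambda>r. z (nth_elem I r)) z y else 0)"

section \<open>The dynamical R-matrix and the L-operator\<close>

text \<open>\<open>R_entry lam z y (a, b) (c, d)\<close> is the coefficient of \<open>v_a \<otimes> v_b\<close> in the image of
  \<open>v_c \<otimes> v_d\<close>.\<close>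

definition R_entry :: "'a::field \<Rightarrow> 'a \<Rightarrow> 'a \<Rightarrow> nat \<times> nat \<Rightarrow> nat \<times> nat \<Rightarrow> 'a" where
  "R_entry lam z y row col =
    (if (row, col) = ((1,1), (1,1)) then 1
     else if (row, col) = ((1,2), (1,2)) then (lam + y) * z / (lam * (z - y))
     else if (row, col) = ((1,2), (2,1)) then - ((lam + z) * y / (lam * (z - y)))
     else if (row, col) = ((2,1), (1,2)) then - ((lam - z) * y / (lam * (z - y)))
     else if (row, col) = ((2,1), (2,1)) then (lam - y) * z / (lam * (z - y))
     else if (row, col) = ((2,2), (2,2)) then 1
     else 0)"

definition tensor_index :: "nat set \<Rightarrow> nat \<Rightarrow> nat" where
  "tensor_index A j = (if j \<in> A then 1 else 2)"

text \<open>The eigenvalue of \<open>\<Sum>j\<in>S. h^(j)\<close> on \<open>v_B\<close>.\<close>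

definition h_weight :: "nat set \<Rightarrow> nat set \<Rightarrow> int" where
  "h_weight S B = (\<Sum>j\<in>S. if j \<in> B then 1 else - 1)"

text \<open>\<open>R_op n p q S lam x y\<close> is \<open>R^(p,q)(lam - y \<Sum>j\<in>S. h^(j), x, y)\<close> acting on the factors
  \<open>0..n\<close>; it is only used with \<open>p, q \<notin> S\<close>, so that \<open>\<Sum>j\<in>S. h^(j)\<close> has the same value on a basis
  vector and on its image.\<close>

definition R_op ::
  "nat \<Rightarrow> nat \<Rightarrow> nat \<Rightarrow> nat set \<Rightarrow> 'a::field \<Rightarrow> 'a \<Rightarrow> 'a \<Rightarrow> (nat set \<Rightarrow> 'a) \<Rightarrow> nat set \<Rightarrow> 'a" where
  "R_op n p q S lam x y \<zeta> A =
    (if A \<subseteq> {0..n} then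
       \<Sum>B | B \<subseteq> {0..n} \<and> B - {p, q} = A - {p, q}.
         R_entry (lam - y * of_int (h_weight S B)) x y
           (tensor_index A p, tensor_index A q) (tensor_index B p, tensor_index B q) * \<zeta> B
     else 0)"

definition L_op ::
  "nat \<Rightarrow> 'a::field \<Rightarrow> 'a \<Rightarrow> (nat \<Rightarrow> 'a) \<Rightarrow> 'a \<Rightarrow> (nat set \<Rightarrow> 'a) \<Rightarrow> nat set \<Rightarrow> 'a" where
  "L_op n lam w z y =
    foldr (\<lambda>m T. R_op n 0 m {m+1..n} lam (w - z m) y \<circ> T) [1..<n+1] id"

text \<open>The coordinates of \<open>v_j \<otimes> u\<close>, the vector \<open>v_j\<close> being placed in the factor 0.\<close>

definition aux_tensor :: "nat \<Rightarrow> (nat set \<Rightarrow> 'a::field) \<Rightarrow> nat set \<Rightarrow> 'a" where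
  "aux_tensor j u A = (if tensor_index A 0 = j then u (A - {0}) else 0)"

text \<open>\<open>L_entry n i j\<close> is \<open>L_ij\<close>: \<open>L_entry n i j lam w z y u\<close> collects the coordinates of
  \<open>L (v_j \<otimes> u)\<close> at the basis vectors \<open>v_i \<otimes> v_A\<close>, for \<open>A \<subseteq> {1..n}\<close>.\<close>

definition L_entry ::
  "nat \<Rightarrow> nat \<Rightarrow> nat \<Rightarrow> 'a::field \<Rightarrow> 'a \<Rightarrow> (nat \<Rightarrow> 'a) \<Rightarrow> 'a \<Rightarrow> (nat set \<Rightarrow> 'a) \<Rightarrow> nat set \<Rightarrow> 'a" where
  "L_entry n i j lam w z y u A =
    (if A \<subseteq> {1..n} then L_op n lam w z y (aux_tensor j u) (if i = 1 then insert 0 A else A) else 0)"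

section \<open>Rational functions in \<open>\<lambda>\<close>, \<open>z\<close>, \<open>y\<close>\<close>

text \<open>
  Polynomials over the complex numbers in the variables number 0, 1, 2, \ldots: number 0 is \<open>y\<close>
  and number \<open>a \<ge> 1\<close> is \<open>z_a\<close>. For given \<open>n\<close> only the variables \<open>0..n\<close> occur. The field
  \<open>ratfun\<close> consists of the rational functions of \<open>\<lambda>\<close> over the fraction field of this ring.
\<close>

type_synonym zy_poly = "(nat \<Rightarrow>\<^sub>0 nat) \<Rightarrow>\<^sub>0 complex"
type_synonym zy_field = "zy_poly fract"
type_synonym ratfun = "zy_field poly fract"

definition zy_var :: "nat \<Rightarrow> zy_field" where
  "zy_var i = Fraction_Field.Fract (Poly_Mapping.single (Poly_Mapping.single i 1) 1) 1"

definition embed_zy :: "zy_field \<Rightarrow> ratfun" where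
  "embed_zy c = Fraction_Field.Fract [:c:] 1"

definition lam_var :: ratfun where "lam_var = Fraction_Field.Fract [:0, 1:] 1"
definition y_var :: ratfun where "y_var = embed_zy (zy_var 0)"
definition z_var :: "nat \<Rightarrow> ratfun" where "z_var a = embed_zy (zy_var a)"

definition polys_in :: "nat set \<Rightarrow> zy_poly set" where
  "polys_in V = {p. \<forall>m\<in>Poly_Mapping.keys p. Poly_Mapping.keys m \<subseteq> V}"

definition C_lam_y :: "ratfun set" where
  "C_lam_y = {Fraction_Field.Fract f 1 | f.
     \<forall>i. coeff f i \<in> (\<lambda>p. Fraction_Field.Fract p 1) ` polys_in {0}}"

definition C_zy :: "nat \<Rightarrow> ratfun set" where
  "C_zy n = {embed_zy (Fraction_Field.Fract p q) | p q.
     p \<in> polys_in {0..n} \<and> q \<in> polys_in {0..n} \<and> q \<noteq> 0}"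

definition L_lam_y :: "ratfun set" where
  "L_lam_y = {f / (\<Prod>l\<leftarrow>ls. lam_var + of_int l * y_var) | f ls. f \<in> C_lam_y}"

text \<open>
  The tensor product of \<open>L_lam_y\<close> and \<open>C_zy n\<close> over the polynomials in \<open>y\<close>, identified with its
  image under multiplication. The multiplication map is injective: the tensor product is a
  localization of the polynomial ring in \<open>\<lambda>\<close> over \<open>C_zy n\<close>.
\<close>

definition L_lam_zy :: "nat \<Rightarrow> ratfun set" where
  "L_lam_zy n = {(\<Sum>i<m. f i * g i) | m f g. \<forall>i<(m::nat). f i \<in> L_lam_y \<and> g i \<in> C_zy n}"

text \<open>The underlying space of \<open>V(z_1) \<otimes> ... \<otimes> V(z_n)\<close>.\<close>

definition V_tensor :: "nat \<Rightarrow> (nat set \<Rightarrow> ratfun) set" where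
  "V_tensor n =
    {\<zeta>. (\<forall>A. A \<subseteq> {1..n} \<longrightarrow> \<zeta> A \<in> L_lam_zy n) \<and> (\<forall>A. \<not> A \<subseteq> {1..n} \<longrightarrow> \<zeta> A = 0)}"

definition xi :: "nat \<Rightarrow> nat set \<Rightarrow> nat set \<Rightarrow> ratfun" where
  "xi n I = xi_fun n I lam_var z_var y_var"

section \<open>The operator \<open>L_22\<close> with shift\<close>

text \<open>\<open>shift_lam c\<close> substitutes \<open>\<lambda> + c\<close> for \<open>\<lambda>\<close>.\<close>

lift_definition shift_lam :: "'a::field \<Rightarrow> 'a poly fract \<Rightarrow> 'a poly fract"
  is "\<lambda>c pq. (pcompose (fst pq) [:c, 1:], pcompose (snd pq) [:c, 1:])"
proof -
  fix c :: 'a and x y :: "'a poly \<times> 'a poly"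
  assume xy: "fractrel x y"
  let ?s = "\<lambda>p. pcompose p [:c, 1:]"
  have deg: "degree [:c, 1:] > 0"
    by simp
  have snd_nz: "snd x \<noteq> 0" "snd y \<noteq> 0" and cross: "fst x * snd y = fst y * snd x"
    using xy unfolding fractrel_def by blast+
  have "?s (fst x) * ?s (snd y) = ?s (fst y) * ?s (snd x)"
    by (simp only: pcompose_mult[symmetric] cross)
  moreover have "?s (snd x) \<noteq> 0" "?s (snd y) \<noteq> 0"
    unfolding pcompose_eq_0_iff[OF deg] using snd_nz by blast+
  ultimately show "fractrel (?s (fst x), ?s (snd x)) (?s (fst y), ?s (snd y))"
    unfolding fractrel_def fst_conv snd_conv by blast
qed

lemma shift_lam_Fract:
  assumes "q \<noteq> 0"
  shows "shift_lam c (Fraction_Field.Fract p q) =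
           Fraction_Field.Fract (pcompose p [:c, 1:]) (pcompose q [:c, 1:])"
proof -
  have deg: "degree [:c, 1:] > 0"
    by simp
  have nz: "pcompose q [:c, 1:] \<noteq> 0"
    unfolding pcompose_eq_0_iff[OF deg] using assms .
  show ?thesis
    unfolding Fraction_Field.Fract_def map_fun_apply id_apply if_not_P[OF assms] if_not_P[OF nz]
    using assms by (subst shift_lam.abs_eq) (simp_all add: eq_onp_def fractrel_def)
qed

text \<open>
  Expansions at \<open>w = \<infinity>\<close> are formal Laurent series in \<open>w\<inverse>\<close>, so \<open>w\<close> itself is \<^const>\<open>fls_X_inv\<close>,
  and division in the field of these series is the expansion of the quotient in powers of
  \<open>w\<inverse>\<close>. Elements of \<^typ>\<open>ratfun\<close> are embedded as constants.
\<close>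

definition w_ser :: "ratfun fls" where "w_ser = fls_X_inv"
definition y_ser :: "ratfun fls" where "y_ser = fls_const y_var"
definition z_ser :: "nat \<Rightarrow> ratfun fls" where "z_ser a = fls_const (z_var a)"
definition lam_ser :: "ratfun fls" where "lam_ser = fls_const lam_var"

definition L22_tilde :: "nat \<Rightarrow> (nat set \<Rightarrow> ratfun) \<Rightarrow> nat set \<Rightarrow> ratfun fls" where
  "L22_tilde n \<zeta> =
    L_entry n 2 2 lam_ser w_ser z_ser y_ser (\<lambda>A. fls_const (shift_lam (zy_var 0) (\<zeta> A)))"

end

theory Submission
  imports Defs
begin

text \<open>
  For \<open>I = {1..k}\<close> all coordinates of \<open>\<xi>_I\<close> except the one at \<open>J = I\<close> vanish, because every summand
  of the weight function then contains a factor \<open>z_a - z_a\<close>; on \<open>v_I\<close> the operator \<open>L_22\<close> is diagonal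
  with a telescoping product of R-matrix entries, and its \<open>\<lambda>\<close>-dependence cancels against the shift
  of the coefficient of \<open>v_I\<close>. All other \<open>I\<close> are reached by adjacent transpositions \<open>s = (a, a+1)\<close>:
  \<open>\<xi>_I\<close> is the image of \<open>\<xi>_(s I)\<close>, with \<open>z_a\<close> and \<open>z_(a+1)\<close> interchanged, under the R-matrix in the factors
  \<open>a, a+1\<close> composed with the flip, and by the dynamical Yang-Baxter equation the same R-matrix
  intertwines the two L-operators. The identity is proved over an arbitrary field for parameters in
  general position and then specialized to the field of Laurent series in \<open>w\<inverse>\<close>.
\<close>

section \<open>The R-matrix as an operator\<close>

text \<open>Over an arbitrary field the interchange of \<open>z_a\<close> and \<open>z_(a+1)\<close>
  is composition of \<open>z\<close> with a transposition, so the induction can quantify over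
  \<open>z\<close> and needs no automorphism of the function field. The substitution of
  \<open>\<lambda> + y\<close> likewise becomes evaluation at \<open>lam + y\<close>:
  \<open>shift_lam\<close> is a field homomorphism and the formula for \<open>\<xi>_I\<close> is a
  rational expression. The delicate point is the exchange relation for the weight functions. It
  holds summand by summand when exactly one of the two sites lies in the index set, but only after
  pairing summands when both do. The twist in \<open>W_minus\<close> by the reversal of the sites
  and by \<open>-\<lambda> - (n-2k)y\<close> is what makes the dynamical parameter of that relation
  equal to the one of the R-matrix in the factors \<open>a, a+1\<close>. Membership of
  \<open>\<xi>_I\<close> in the coefficient space is a separate matter: all denominators in its
  formula are free of \<open>\<lambda>\<close>.\<close>

definition swap_mem :: "nat \<Rightarrow> nat \<Rightarrow> nat set \<Rightarrow> nat set" where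
  "swap_mem p q A = (if p \<in> A then insert q (A - {p}) else insert p (A - {q}))"

text \<open>The entries of the R-matrix on the span of \<open>v_1 \<otimes> v_2\<close> and \<open>v_2 \<otimes> v_1\<close>; the Boolean tells whether
  the row is the one of \<open>v_1 \<otimes> v_2\<close>.\<close>

definition R_diag :: "'a::field \<Rightarrow> 'a \<Rightarrow> 'a \<Rightarrow> bool \<Rightarrow> 'a" where
  "R_diag lam x y b = (if b then (lam + y) * x / (lam * (x - y)) else (lam - y) * x / (lam * (x - y)))"

definition R_off :: "'a::field \<Rightarrow> 'a \<Rightarrow> 'a \<Rightarrow> bool \<Rightarrow> 'a" where
  "R_off lam x y b = (if b then - ((lam + x) * y / (lam * (x - y))) else - ((lam - x) * y / (lam * (x - y))))"

lemma h_weight_swap_mem: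
  assumes "p \<notin> S" "q \<notin> S"
  shows "h_weight S (swap_mem p q A) = h_weight S A"
  unfolding h_weight_def swap_mem_def using assms by (intro sum.cong) auto

lemma h_weight_cong:
  assumes "\<And>j. j \<in> S \<Longrightarrow> j \<in> A \<longleftrightarrow> j \<in> B"
  shows "h_weight S A = h_weight S B"
  unfolding h_weight_def using assms by (intro sum.cong) auto

text \<open>The R-matrix conserves weight, so among the four sets \<open>B\<close> agreeing with
  \<open>A\<close> off \<open>{p, q}\<close> only \<open>A\<close> itself and its swap can
  contribute, the latter only when \<open>A\<close> contains exactly one of \<open>p, q\<close>.
  Outside that case \<open>swap_mem\<close> has no meaning and is not evaluated.\<close>

lemma R_op_alt:
  assumes pq: "p \<noteq> q" "p \<le> n" "q \<le> n" "p \<notin> S" "q \<notin> S"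
  shows "R_op n p q S lam x y \<zeta> A =
    (if A \<subseteq> {0..n} then
       if (p \<in> A) = (q \<in> A) then \<zeta> A
       else R_diag (lam - y * of_int (h_weight S A)) x y (p \<in> A) * \<zeta> A
          + R_off (lam - y * of_int (h_weight S A)) x y (p \<in> A) * \<zeta> (swap_mem p q A)
     else 0)"
proof (cases "A \<subseteq> {0..n}")
  case True
  define C where "C = A - {p, q}"
  have C: "C \<subseteq> {0..n}" "p \<notin> C" "q \<notin> C"
    using True by (auto simp: C_def)
  have eq: "{B. B \<subseteq> {0..n} \<and> B - {p, q} = A - {p, q}} = {C, insert p C, insert q C, insert p (insert q C)}"
  proof (intro equalityI subsetI)
    fix B assume "B \<in> {B. B \<subseteq> {0..n} \<and> B - {p, q} = A - {p, q}}"
    then have "B - {p, q} = C" by (simp add: C_def)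
    then have "B = C \<or> B = insert p C \<or> B = insert q C \<or> B = insert p (insert q C)"
      by (cases "p \<in> B"; cases "q \<in> B") auto
    then show "B \<in> {C, insert p C, insert q C, insert p (insert q C)}" by simp
  next
    fix B assume "B \<in> {C, insert p C, insert q C, insert p (insert q C)}"
    then show "B \<in> {B. B \<subseteq> {0..n} \<and> B - {p, q} = A - {p, q}}"
      using C pq unfolding C_def[symmetric] by auto
  qed
  have ne: "C \<noteq> insert p C" "C \<noteq> insert q C" "insert p C \<noteq> insert q C"
    "C \<noteq> insert p (insert q C)" "insert p C \<noteq> insert p (insert q C)" "insert q C \<noteq> insert p (insert q C)"
    using C pq by auto
  have h: "h_weight S (insert p B) = h_weight S B" "h_weight S (insert q B) = h_weight S B" for B
    using pq by (auto intro!: h_weight_cong)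
  have A: "A = C \<or> A = insert p C \<or> A = insert q C \<or> A = insert p (insert q C)"
    unfolding C_def by (cases "p \<in> A"; cases "q \<in> A") auto
  have sw: "swap_mem p q (insert p C) = insert q C" "swap_mem p q (insert q C) = insert p C"
    using C pq by (auto simp: swap_mem_def)
  show ?thesis
    unfolding R_op_def eq using A True ne C pq sw
    by (auto simp: R_entry_def tensor_index_def R_diag_def R_off_def h)
qed (simp add: R_op_def)

text \<open>\<open>R_op\<close> sees the factors only through membership in sets, so precomposing
  coordinates with a permutation of the factors renames the factor numbers. Needed for the flip of
  two neighbouring factors.\<close>

lemma R_op_relabel:
  fixes s :: "nat \<Rightarrow> nat"
  assumes s: "bij s" "\<And>i. s i \<le> n \<longleftrightarrow> i \<le> n"
    and pq: "p \<noteq> q" "p \<le> n" "q \<le> n" "p \<notin> S" "q \<notin> S"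
  shows "R_op n p q S lam x y (\<lambda>A. \<zeta> (s ` A)) A = R_op n (s p) (s q) (s ` S) lam x y \<zeta> (s ` A)"
proof -
  have inj: "inj s" using s(1) by (rule bij_is_inj)
  have m: "s i \<in> s ` B \<longleftrightarrow> i \<in> B" for i B
    using inj by (simp add: inj_image_mem_iff)
  have sub: "s ` A \<subseteq> {0..n} \<longleftrightarrow> A \<subseteq> {0..n}"
    using s(2) by auto
  have h: "h_weight (s ` S) (s ` A) = h_weight S A"
    unfolding h_weight_def using inj by (subst sum.reindex) (auto simp: m inj_on_def)
  have sw: "s ` swap_mem p q A = swap_mem (s p) (s q) (s ` A)"
    unfolding swap_mem_def m using inj by (simp add: image_set_diff)
  have ne: "s p \<noteq> s q" using inj pq(1) by (simp add: inj_eq)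
  show ?thesis
    using pq ne by (subst (1 2) R_op_alt) (simp_all add: m s(2) sub h sw)
qed

text \<open>Disjoint pairs alone do not suffice, because each operator may change the dynamical
  argument of the other. It does not when \<open>S\<close> contains both or none of
  \<open>p', q'\<close>: the second operator conserves their joint weight. Symmetrically for
  \<open>T\<close>.\<close>

lemma R_op_commute:
  assumes d: "p \<noteq> q" "p' \<noteq> q'" "{p, q} \<inter> {p', q'} = {}"
    and le: "p \<le> n" "q \<le> n" "p' \<le> n" "q' \<le> n"
    and S: "p \<notin> S" "q \<notin> S" "p' \<in> S \<longleftrightarrow> q' \<in> S" "finite S"
    and T: "p' \<notin> T" "q' \<notin> T" "p \<in> T \<longleftrightarrow> q \<in> T" "finite T"
  shows "R_op n p q S lam x y (R_op n p' q' T lam' x' y \<zeta>) =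
         R_op n p' q' T lam' x' y (R_op n p q S lam x y \<zeta>)"
proof
  fix A
  \<comment> \<open>If both \<open>a\<close> and \<open>b\<close> are in \<open>U\<close>, their
    contributions \<open>1\<close> and \<open>-1\<close> merely trade places.\<close>
  have h: "h_weight U (swap_mem a b A) = h_weight U A"
    if "finite U" "a \<noteq> b" "a \<in> U \<longleftrightarrow> b \<in> U" "(a \<in> A) \<noteq> (b \<in> A)" for U a b
  proof (cases "a \<in> U")
    case False
    then show ?thesis using that by (intro h_weight_swap_mem) auto
  next
    case True
    then have U: "U = insert a (insert b (U - {a, b}))" using that by auto
    have *: "h_weight U B = (if a \<in> B then 1 else -1) + ((if b \<in> B then 1 else -1) + h_weight (U - {a,b}) B)" for B
      unfolding h_weight_def using that(1,2) by (subst U) auto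
    have "h_weight (U - {a,b}) (swap_mem a b A) = h_weight (U - {a,b}) A"
      by (intro h_weight_swap_mem) auto
    then show ?thesis using that(2,4) unfolding *[of A] *[of "swap_mem a b A"]
      by (auto simp: swap_mem_def)
  qed
  have m1: "(p \<in> swap_mem p' q' A) = (p \<in> A)" "(q \<in> swap_mem p' q' A) = (q \<in> A)"
       "(p' \<in> swap_mem p q A) = (p' \<in> A)" "(q' \<in> swap_mem p q A) = (q' \<in> A)"
    using d by (auto simp: swap_mem_def)
  have m2: "swap_mem p q A \<subseteq> {0..n} \<longleftrightarrow> A \<subseteq> {0..n}" if "(p \<in> A) \<noteq> (q \<in> A)"
    using le that by (auto simp: swap_mem_def)
  have m3: "swap_mem p' q' A \<subseteq> {0..n} \<longleftrightarrow> A \<subseteq> {0..n}" if "(p' \<in> A) \<noteq> (q' \<in> A)"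
    using le that by (auto simp: swap_mem_def)
  have c: "swap_mem p q (swap_mem p' q' A) = swap_mem p' q' (swap_mem p q A)"
    using d unfolding swap_mem_def by auto
  show "R_op n p q S lam x y (R_op n p' q' T lam' x' y \<zeta>) A =
         R_op n p' q' T lam' x' y (R_op n p q S lam x y \<zeta>) A"
    unfolding R_op_alt[OF d(1) le(1,2) S(1,2)] R_op_alt[OF d(2) le(3,4) T(1,2)]
    using h[OF S(4) d(2) S(3)] h[OF T(4) d(1) T(3)]
    by (simp add: m1 m2 m3 c algebra_simps)
qed

text \<open>The matrix entries of the dynamical Yang-Baxter equation on the three basis vectors with
  a single \<open>v_1\<close> in the factors \<open>p, q, r\<close>. In the labels the letter is the
  row and the digit the column, both in the order \<open>p, q, r\<close>; \<open>l + y\<close>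
  replaces \<open>l\<close> when the factor entering the dynamical argument carries
  \<open>v_2\<close>.\<close>

lemma R_coefficient_identities:
  assumes "l \<noteq> 0" "l + y \<noteq> 0" "x - y \<noteq> 0" "x' - y \<noteq> 0" "x' - x - y \<noteq> 0"
  defines "D \<equiv> \<lambda>l x b. R_diag l x y b" and "O' \<equiv> \<lambda>l x b. R_off l x y b"
  shows "D (l + y) x True * D l x' True = D (l + y) x' True * D l x True" (is ?a1)
   and "D (l + y) x True * (O' l x' True * O' (l + y) (x' - x) False) + O' (l + y) x True * D (l + y) (x' - x) True
      = D (l + y) x' True * O' l x True" (is ?a2)
   and "D (l + y) x True * (O' l x' True * D (l + y) (x' - x) False) + O' (l + y) x True * O' (l + y) (x' - x) True
      = O' (l + y) x' True" (is ?a3)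
   and "O' (l + y) x False * D l x' True = D l (x' - x) True * O' l x False
      + O' l (x' - x) True * (O' (l + y) x' False * D l x True)" (is ?b1)
   and "D (l + y) x False * D (l + y) (x' - x) True
      + O' (l + y) x False * (O' l x' True * O' (l + y) (x' - x) False)
      = D l (x' - x) True * D l x False + O' l (x' - x) True * (O' (l + y) x' False * O' l x True)" (is ?b2)
   and "D (l + y) x False * O' (l + y) (x' - x) True
      + O' (l + y) x False * (O' l x' True * D (l + y) (x' - x) False)
      = O' l (x' - x) True * D (l + y) x' False" (is ?b3)
   and "O' l x' False = D l (x' - x) False * (O' (l + y) x' False * D l x True) + O' l (x' - x) False * O' l x False" (is ?c1)
   and "D l x' False * O' (l + y) (x' - x) False = D l (x' - x) False * (O' (l + y) x' False * O' l x True)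
      + O' l (x' - x) False * D l x False" (is ?c2)
   and "D l x' False * D (l + y) (x' - x) False = D l (x' - x) False * D (l + y) x' False" (is ?c3)
proof -
  \<comment> \<open>With the denominators as atoms, \<open>divide_simps\<close> clears them without
    expanding; what remains is polynomial modulo the four defining equations.\<close>
  define m u v w where "m = l + y" and "u = x - y" and "v = x' - y" and "w = x' - x - y"
  have nz: "l \<noteq> 0" "m \<noteq> 0" "u \<noteq> 0" "v \<noteq> 0" "w \<noteq> 0"
    using assms(1-5) by (simp_all add: m_def u_def v_def w_def)
  note fold = m_def[symmetric] u_def[symmetric] v_def[symmetric] w_def[symmetric]
  note ev = D_def O'_def R_diag_def R_off_def if_True if_False fold
  show ?a1
    unfolding ev using nz by (simp add: divide_simps)
  show ?a2
    unfolding ev using nz by (simp add: divide_simps) (use m_def u_def v_def w_def in algebra)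
  show ?a3
    unfolding ev using nz by (simp add: divide_simps) (use m_def u_def v_def w_def in algebra)
  show ?b1
    unfolding ev using nz by (simp add: divide_simps) (use m_def u_def v_def w_def in algebra)
  show ?b2
    unfolding ev using nz by (simp add: divide_simps) (use m_def u_def v_def w_def in algebra)
  show ?b3
    unfolding ev using nz by (simp add: divide_simps) (use m_def u_def v_def w_def in algebra)
  show ?c1
    unfolding ev using nz by (simp add: divide_simps) (use m_def u_def v_def w_def in algebra)
  show ?c2
    unfolding ev using nz by (simp add: divide_simps) (use m_def u_def v_def w_def in algebra)
  show ?c3
    unfolding ev using nz by (simp add: divide_simps)
qed

text \<open>Exchanging \<open>v_1\<close> and \<open>v_2\<close> in both factors amounts to negating
  the dynamical parameter. This transfers the identities for one \<open>v_1\<close> among three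
  factors to the case of two.\<close>

lemma R_diag_minus: "R_diag (- l) x y b = R_diag l x y (\<not> b)"
  and R_off_minus: "R_off (- l) x y b = R_off l x y (\<not> b)"
  by (auto simp: R_diag_def R_off_def divide_simps algebra_simps)

text \<open>\<open>P, Q, R\<close> stand for the coordinates of the vector at the three basis
  vectors of a weight space; the hypotheses here and in the next two lemmas compare their
  coefficients.\<close>

lemma linear_row_1:
  fixes P Q R :: "'a::field"
  assumes "a1 * b1 = c1 * d1" "a1 * (b2 * b4) + a2 * b5 = c1 * d2" "a1 * (b2 * b3) + a2 * b6 = c2"
  shows "a1 * (b1 * P + b2 * (b3 * R + b4 * Q)) + a2 * (b5 * Q + b6 * R) = c1 * (d1 * P + d2 * Q) + c2 * R"
  using assms by algebra

lemma linear_row_2: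
  fixes P Q R :: "'a::field"
  assumes "a2 * b3 = c1 * d2 + c2 * (d4 * d5)" "a1 * b1 + a2 * (b4 * b6) = c1 * d1 + c2 * (d4 * d6)"
     "a1 * b2 + a2 * (b4 * b5) = c2 * d3"
  shows "a1 * (b1 * Q + b2 * R) + a2 * (b3 * P + b4 * (b5 * R + b6 * Q)) =
     c1 * (d1 * Q + d2 * P) + c2 * (d3 * R + d4 * (d5 * P + d6 * Q))"
  using assms by algebra

lemma linear_row_3:
  fixes P Q R :: "'a::field"
  assumes "a2 = c1 * (d2 * d3) + c2 * d6" "a1 * b2 = c1 * (d2 * d4) + c2 * d5" "a1 * b1 = c1 * d1"
  shows "a1 * (b1 * R + b2 * Q) + a2 * P = c1 * (d1 * R + d2 * (d3 * P + d4 * Q)) + c2 * (d5 * Q + d6 * P)"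
  using assms by algebra

text \<open>Both sides leave the factors outside \<open>p, q, r\<close> alone; these enter only
  through the effective parameter \<open>l\<close>. The three active factors split by their number
  of \<open>v_1\<close> into blocks of size 1, 3, 3, 1, and the blocks of size 1 are
  trivial.\<close>

lemma dynamical_Yang_Baxter:
  assumes d: "p \<noteq> q" "p \<noteq> r" "q \<noteq> r" and le: "p \<le> n" "q \<le> n" "r \<le> n"
    and S: "finite S" "p \<notin> S" "q \<notin> S" "r \<notin> S"
    and gen: "\<And>l::int. lam + of_int l * y \<noteq> 0" "x - y \<noteq> 0" "x' - y \<noteq> 0" "x' - x - y \<noteq> 0"
  shows "R_op n p q (insert r S) lam x y (R_op n p r S lam x' y (R_op n q r (insert p S) lam (x' - x) y \<zeta>)) =
         R_op n q r S lam (x' - x) y (R_op n p r (insert q S) lam x' y (R_op n p q S lam x y \<zeta>))"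

proof
  fix A
  define C where "C = A - {p, q, r}"
  define h where "h = h_weight S C"
  define l where "l = lam - y * of_int h"
  have C: "p \<notin> C" "q \<notin> C" "r \<notin> C" by (auto simp: C_def)
  have l: "l \<noteq> 0" "l + y \<noteq> 0" "l - y \<noteq> 0"
    using gen(1)[of "- h"] gen(1)[of "1 - h"] gen(1)[of "- 1 - h"]
    by (simp_all add: l_def algebra_simps)
  have hi: "h_weight S (insert p B) = h_weight S B" "h_weight S (insert q B) = h_weight S B"
      "h_weight S (insert r B) = h_weight S B" for B
    using S by (auto intro!: h_weight_cong)
  have hS: "h_weight (insert u S) B = (if u \<in> B then 1 else -1) + h_weight S B" if "u \<notin> S" for u B
    unfolding h_weight_def using that S(1) by auto
  have lam: "lam - y * of_int h = l" "lam - y * of_int (1 + h) = l - y" "lam - y * of_int (- 1 + h) = l + y"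
    "lam - y * of_int (h - 1) = l + y" "lam - y * (1 + of_int h) = l - y"
    "lam - y * (of_int h - 1) = l + y" "lam - y * (-1 + of_int h) = l + y"
    by (simp_all add: l_def algebra_simps)
  have d': "q \<noteq> p" "r \<noteq> p" "r \<noteq> q" using d by auto
  have Cs: "insert p C \<subseteq> {0..n} \<longleftrightarrow> C \<subseteq> {0..n}" "insert q C \<subseteq> {0..n} \<longleftrightarrow> C \<subseteq> {0..n}"
     "insert r C \<subseteq> {0..n} \<longleftrightarrow> C \<subseteq> {0..n}" using le by auto
  have A: "A = C \<or> A = insert p C \<or> A = insert q C \<or> A = insert r C \<or> A = insert p (insert q C)
    \<or> A = insert p (insert r C) \<or> A = insert q (insert r C) \<or> A = insert p (insert q (insert r C))"
    unfolding C_def by (cases "p \<in> A"; cases "q \<in> A"; cases "r \<in> A") auto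
  have S': "p \<notin> insert r S" "q \<notin> insert r S" "q \<notin> insert p S" "r \<notin> insert p S" "p \<notin> insert q S" "r \<notin> insert q S"
    using S d by auto
  note alt = R_op_alt[OF d(1) le(1,2)] R_op_alt[OF d(2) le(1,3)] R_op_alt[OF d(3) le(2,3)]
  note ev = alt S S' swap_mem_def insert_Diff_if insert_commute hi hS h_def[symmetric] lam C d d' le Cs
  show "R_op n p q (insert r S) lam x y (R_op n p r S lam x' y (R_op n q r (insert p S) lam (x' - x) y \<zeta>)) A =
         R_op n q r S lam (x' - x) y (R_op n p r (insert q S) lam x' y (R_op n p q S lam x y \<zeta>)) A"
  proof (cases "C \<subseteq> {0..n}")
    case True
    note plus = R_coefficient_identities[OF l(1,2) gen(2-4)]
    \<comment> \<open>With two \<open>v_1\<close> the effective parameters are \<open>l\<close> and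
      \<open>l - y\<close>, which up to sign are \<open>- l\<close> and
      \<open>- l + y\<close>.\<close>
    have "- l \<noteq> 0" "- l + y \<noteq> 0" using l by auto
    note minus = R_coefficient_identities[OF this gen(2-4)]
    have ml: "- l + y = - (l - y)" by simp
    note minus = minus[unfolded ml R_diag_minus R_off_minus, simplified]
    from A show ?thesis
      apply (elim disjE)
      apply (simp_all add: ev True)
      \<comment> \<open>The remaining cases have \<open>v_1\<close> at \<open>p\<close>,
        \<open>q\<close>, \<open>r\<close>, then \<open>v_2\<close> at \<open>r\<close>,
        \<open>q\<close>, \<open>p\<close>, so the rows come back in reverse order.\<close>
      subgoal by (rule linear_row_1) (rule plus)+
      subgoal by (rule linear_row_2) (rule plus)+
      subgoal by (rule linear_row_3) (rule plus)+
      subgoal by (rule linear_row_3) (rule minus)+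
      subgoal by (rule linear_row_2) (rule minus)+
      subgoal by (rule linear_row_1) (rule minus)+
      done
  next
    case False
    then have "\<not> A \<subseteq> {0..n}" by (auto simp: C_def)
    then show ?thesis by (simp add: R_op_def)
  qed
qed

section \<open>Exchange relation for the L-operator\<close>

definition L_seg :: "nat \<Rightarrow> 'a::field \<Rightarrow> 'a \<Rightarrow> (nat \<Rightarrow> 'a) \<Rightarrow> 'a \<Rightarrow> nat list \<Rightarrow> (nat set \<Rightarrow> 'a) \<Rightarrow> nat set \<Rightarrow> 'a" where
  "L_seg n lam w z y ms \<zeta> = foldr (\<lambda>m. R_op n 0 m {m+1..n} lam (w - z m) y) ms \<zeta>"

lemma L_op_eq_seg: "L_op n lam w z y \<zeta> = L_seg n lam w z y [1..<n+1] \<zeta>"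
proof -
  have "foldr (\<lambda>m T. R_op n 0 m {m+1..n} lam (w - z m) y \<circ> T) ms id \<zeta> = L_seg n lam w z y ms \<zeta>" for ms
    by (induction ms) (simp_all add: L_seg_def)
  then show ?thesis unfolding L_op_def .
qed

lemma foldr_commute:
  assumes "\<And>m \<zeta>. m \<in> set ms \<Longrightarrow> F m (X \<zeta>) = X (G m \<zeta>)"
  shows "foldr F ms (X \<zeta>) = X (foldr G ms \<zeta>)"
  using assms by (induction ms) auto

text \<open>The R-matrix commutes with the factors \<open>a+2..n\<close> of the L-operator; at the
  factors \<open>a, a+1\<close> the Yang-Baxter equation interchanges these and removes
  \<open>h^(0)\<close> from its argument; then it commutes with the factors \<open>1..a-1\<close>.
  After the flip \<open>P\<close> the interchanged product is the L-operator for
  \<open>z \<circ> s\<close>.\<close>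

lemma L_op_exchange:
  fixes lam w y :: "'a::field" and z :: "nat \<Rightarrow> 'a" and a n :: nat
  defines "s \<equiv> transpose a (a + 1)"
  assumes a: "1 \<le> a" "a + 1 \<le> n"
    and gen: "\<And>l::int. lam + of_int l * y \<noteq> 0" "\<And>i. i \<in> {1..n} \<Longrightarrow> w - z i - y \<noteq> 0" "z a - z (a + 1) - y \<noteq> 0"
  shows "L_op n lam w z y (R_op n a (a + 1) (insert 0 {a+2..n}) lam (z a - z (a + 1)) y \<zeta>) =
    R_op n a (a + 1) {a+2..n} lam (z a - z (a + 1)) y
      (\<lambda>A. L_op n lam w (z \<circ> s) y (\<lambda>B. \<zeta> (s ` B)) (s ` A))"
proof -
  define S where "S = {a+2..n}"
  define P :: "(nat set \<Rightarrow> 'a) \<Rightarrow> nat set \<Rightarrow> 'a" where "P = (\<lambda>\<zeta> A. \<zeta> (s ` A))"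
  define F where "F = (\<lambda>m. R_op n 0 m {m+1..n} lam (w - z m) y)"
  define F' where "F' = (\<lambda>m. R_op n 0 m {m+1..n} lam (w - (z \<circ> s) m) y)"
  define X1 where "X1 = R_op n a (a + 1) (insert 0 S) lam (z a - z (a + 1)) y"
  define X2 where "X2 = R_op n a (a + 1) S lam (z a - z (a + 1)) y"
  define G1 where "G1 = R_op n 0 (a + 1) (insert a S) lam (w - z (a + 1)) y"
  define G2 where "G2 = R_op n 0 a S lam (w - z a) y"
  have split: "[1..<n+1] = [1..<a] @ [a, a + 1] @ [a+2..<n+1]"
  proof -
    have "[1..<n+1] = [1..<a] @ [a..<n+1]"
      using a upt_add_eq_append[of 1 a "n + 1 - a"] by simp
    moreover have "[a..<n+1] = a # (a + 1) # [a+2..<n+1]" using a by (simp add: upt_conv_Cons)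
    ultimately show ?thesis by simp
  qed
  have sS: "{a + 1..n} = insert (a + 1) S" "{a + 2..n} = S" using a by (auto simp: S_def)
  \<comment> \<open>Yang-Baxter with \<open>x = w - z a\<close> and
    \<open>x' = w - z (a + 1)\<close>: the difference \<open>x' - x\<close> does not involve
    \<open>w\<close>.\<close>
  have mid: "F a (F (a + 1) (X1 \<eta>)) = X2 (G1 (G2 \<eta>))" for \<eta>
  proof -
    have "R_op n 0 a (insert (a + 1) S) lam (w - z a) y (R_op n 0 (a + 1) S lam (w - z (a + 1)) y
        (R_op n a (a + 1) (insert 0 S) lam ((w - z (a + 1)) - (w - z a)) y \<eta>)) =
      R_op n a (a + 1) S lam ((w - z (a + 1)) - (w - z a)) y
        (R_op n 0 (a + 1) (insert a S) lam (w - z (a + 1)) y (R_op n 0 a S lam (w - z a) y \<eta>))"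
      by (rule dynamical_Yang_Baxter) (use a gen in \<open>auto simp: S_def\<close>)
    then show ?thesis by (simp add: F_def X1_def X2_def G1_def G2_def sS[simplified])
  qed
  have hi: "F m (X1 \<eta>) = X1 (F m \<eta>)" if "m \<in> set [a+2..<n+1]" for m \<eta>
    unfolding F_def X1_def by (rule R_op_commute) (use a that in \<open>auto simp: S_def\<close>)
  have lo: "F m (X2 \<eta>) = X2 (F m \<eta>)" if "m \<in> set [1..<a]" for m \<eta>
    unfolding F_def X2_def by (rule R_op_commute) (use a that in \<open>auto simp: S_def\<close>)
  have s: "bij s" "\<And>i. s i \<le> n \<longleftrightarrow> i \<le> n" "s 0 = 0" "s a = a + 1" "s (a + 1) = a"
    "\<And>i. i \<noteq> a \<Longrightarrow> i \<noteq> a + 1 \<Longrightarrow> s i = i"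
    using a by (auto simp: s_def Transposition.transpose_def)
  have sim: "s ` T = T" if "a \<in> T \<longleftrightarrow> a + 1 \<in> T" for T
    unfolding s_def using that by (rule transpose_image_eq)
  have relabel: "R_op n p q T lam x y (P \<eta>) = P (R_op n (s p) (s q) (s ` T) lam x y \<eta>)"
    if "p \<noteq> q" "p \<le> n" "q \<le> n" "p \<notin> T" "q \<notin> T" for p q T x \<eta>
    unfolding P_def using R_op_relabel[OF s(1,2) that] by (intro ext) auto
  have F'P: "F' m (P \<eta>) = P (F m \<eta>)" if "m \<in> set [a+2..<n+1] \<or> m \<in> set [1..<a]" for m \<eta>
  proof -
    have "s m = m" using that by (intro s) auto
    moreover have "s ` {m+1..n} = {m+1..n}" using that a by (intro sim) auto
    ultimately show ?thesis unfolding F'_def F_def using that a by (subst relabel) (auto simp: s)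
  qed
  have c1: "foldr F' [a+2..<n+1] (P \<eta>) = P (foldr F [a+2..<n+1] \<eta>)" for \<eta>
    by (rule foldr_commute[where X = P]) (rule F'P, blast)
  have c2: "foldr F' [1..<a] (P \<eta>) = P (foldr F [1..<a] \<eta>)" for \<eta>
    by (rule foldr_commute[where X = P]) (rule F'P, blast)
  have Fa: "F' a (P \<eta>) = P (G1 \<eta>)" for \<eta>
  proof -
    have "s ` {a+1..n} = insert a S" unfolding sS using sim[of S] by (simp add: s(5)[simplified] S_def)
    then show ?thesis unfolding F'_def G1_def using a by (subst relabel) (auto simp: s)
  qed
  have Fb: "F' (a + 1) (P \<eta>) = P (G2 \<eta>)" for \<eta>
  proof -
    have "s ` {a+1+1..n} = S" using sim[of S] by (simp add: S_def)
    then show ?thesis unfolding F'_def G2_def using a by (subst relabel) (auto simp: s(3) s(5)[simplified])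
  qed
  have "foldr F' [1..<n+1] (P \<zeta>) = P (foldr F [1..<a] (G1 (G2 (foldr F [a+2..<n+1] \<zeta>))))"
    unfolding split by (simp only: foldr_append foldr.simps comp_apply id_apply c1 c2 Fa Fb)
  then have "P (foldr F' [1..<n+1] (P \<zeta>)) = foldr F [1..<a] (G1 (G2 (foldr F [a+2..<n+1] \<zeta>)))"
    by (simp add: P_def s_def image_image del: upt_Suc)
  moreover have "foldr F [1..<n+1] (X1 \<zeta>) = X2 (foldr F [1..<a] (G1 (G2 (foldr F [a+2..<n+1] \<zeta>))))"
    unfolding split
    by (simp only: foldr_append foldr.simps comp_apply id_apply mid
        foldr_commute[of "[a+2..<n+1]" F X1 F, OF hi] foldr_commute[of "[1..<a]" F X2 F, OF lo])
  ultimately have "foldr F [1..<n+1] (X1 \<zeta>) = X2 (P (foldr F' [1..<n+1] (P \<zeta>)))" by simp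
  then show ?thesis
    unfolding L_op_eq_seg L_seg_def F_def[symmetric] F'_def[symmetric] sS X1_def[symmetric] X2_def[symmetric]
    by (simp only: P_def)
qed

text \<open>The shift \<open>\<lambda> \<mapsto> \<lambda> + y\<close> in \<open>L22_tilde\<close> is the contribution of \<open>h^(0) = -1\<close> on \<open>v_2\<close> in the auxiliary
  factor to the dynamical argument of the R-matrix.\<close>

lemma aux_tensor_R_op:
  assumes "1 \<le> p" "1 \<le> q" "p \<noteq> q" "p \<le> n" "q \<le> n" "p \<notin> S" "q \<notin> S" "finite S" "0 \<notin> S"
  shows "aux_tensor 2 (R_op n p q S (lam + y) x y u) = R_op n p q (insert 0 S) lam x y (aux_tensor 2 u)"
proof
  fix A
  have h: "h_weight (insert 0 S) A = h_weight S A - 1" if "0 \<notin> A"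
    using that assms(8,9) by (simp add: h_weight_def)
  have sw: "0 \<in> swap_mem p q A \<longleftrightarrow> 0 \<in> A" using assms by (auto simp: swap_mem_def)
  have n0: "p \<notin> insert 0 S" "q \<notin> insert 0 S" using assms by auto
  show "aux_tensor 2 (R_op n p q S (lam + y) x y u) A = R_op n p q (insert 0 S) lam x y (aux_tensor 2 u) A"
    unfolding R_op_alt[OF assms(3,4,5) n0] unfolding aux_tensor_def R_op_alt[OF assms(3-7)]
    using assms by (auto simp: tensor_index_def sw h right_diff_distrib diff_diff_eq2)
qed

text \<open>The inner R-matrix has parameter \<open>lam + y\<close>: on a vector with
  \<open>v_2\<close> in the auxiliary factor this is the R-matrix with \<open>h^(0)\<close> in its
  argument, as \<open>L_op_exchange\<close> requires. The outer one does not touch factor 0, so the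
  component with \<open>v_2\<close> there can be read off.\<close>

lemma L_entry_exchange:
  fixes lam w y :: "'a::field" and z :: "nat \<Rightarrow> 'a" and a n :: nat
  defines "s \<equiv> transpose a (a + 1)"
  assumes a: "1 \<le> a" "a + 1 \<le> n"
    and gen: "\<And>l::int. lam + of_int l * y \<noteq> 0" "\<And>i. i \<in> {1..n} \<Longrightarrow> w - z i - y \<noteq> 0" "z a - z (a + 1) - y \<noteq> 0"
    and A: "A \<subseteq> {1..n}"
  shows "L_entry n 2 2 lam w z y (R_op n a (a + 1) {a+2..n} (lam + y) (z a - z (a + 1)) y (\<lambda>B. u (s ` B))) A =
    R_op n a (a + 1) {a+2..n} lam (z a - z (a + 1)) y (\<lambda>B. L_entry n 2 2 lam w (z \<circ> s) y u (s ` B)) A"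
proof -
  have s: "s ` B \<subseteq> {1..n} \<longleftrightarrow> B \<subseteq> {1..n}" "0 \<in> s ` B \<longleftrightarrow> 0 \<in> B" for B
  proof -
    have "s i \<in> {1..n} \<longleftrightarrow> i \<in> {1..n}" "s i = 0 \<longleftrightarrow> i = 0" for i using a by (auto simp: s_def Transposition.transpose_def)
    then show "s ` B \<subseteq> {1..n} \<longleftrightarrow> B \<subseteq> {1..n}" "0 \<in> s ` B \<longleftrightarrow> 0 \<in> B"
      by (auto simp: image_subset_iff image_iff subset_iff)
  qed
  have P: "(\<lambda>B. aux_tensor 2 (\<lambda>B. u (s ` B)) (s ` B)) = aux_tensor 2 u"
  proof
    fix B
    have "s 0 = 0" using a by (simp add: s_def Transposition.transpose_def)
    then have "s ` (s ` B - {0}) = B - {0}"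
      by (subst image_set_diff) (auto simp: s_def image_image)
    then show "aux_tensor 2 (\<lambda>B. u (s ` B)) (s ` B) = aux_tensor 2 u B"
      by (simp add: aux_tensor_def tensor_index_def s)
  qed
  have eq: "aux_tensor 2 (R_op n a (a + 1) {a+2..n} (lam + y) (z a - z (a + 1)) y (\<lambda>B. u (s ` B))) =
     R_op n a (a + 1) (insert 0 {a+2..n}) lam (z a - z (a + 1)) y (aux_tensor 2 (\<lambda>B. u (s ` B)))"
    by (rule aux_tensor_R_op) (use a in auto)
  have ex: "L_op n lam w z y (R_op n a (a + 1) (insert 0 {a+2..n}) lam (z a - z (a + 1)) y (aux_tensor 2 (\<lambda>B. u (s ` B)))) =
     R_op n a (a + 1) {a+2..n} lam (z a - z (a + 1)) y (\<lambda>B. L_op n lam w (z \<circ> s) y (aux_tensor 2 u) (s ` B))"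
    using L_op_exchange[OF a gen, of "aux_tensor 2 (\<lambda>B. u (s ` B))"] unfolding s_def[symmetric] P .
  have "L_entry n 2 2 lam w z y (R_op n a (a + 1) {a+2..n} (lam + y) (z a - z (a + 1)) y (\<lambda>B. u (s ` B))) A =
    R_op n a (a + 1) {a+2..n} lam (z a - z (a + 1)) y (\<lambda>B. L_op n lam w (z \<circ> s) y (aux_tensor 2 u) (s ` B)) A"
    using A unfolding L_entry_def eq ex by simp
  also have "\<dots> = R_op n a (a + 1) {a+2..n} lam (z a - z (a + 1)) y (\<lambda>B. L_entry n 2 2 lam w (z \<circ> s) y u (s ` B)) A"
  proof -
    have sw: "swap_mem a (a + 1) A \<subseteq> {1..n}" using A a by (auto simp: swap_mem_def)
    have e: "L_entry n 2 2 lam w (z \<circ> s) y u (s ` B) = L_op n lam w (z \<circ> s) y (aux_tensor 2 u) (s ` B)"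
      if "B \<subseteq> {1..n}" for B
      unfolding L_entry_def using that s(1)[of B] by simp
    show ?thesis using a by (subst (1 2) R_op_alt) (simp_all add: e[OF A, simplified] e[OF sw, simplified])
  qed
  finally show ?thesis .
qed

section \<open>The L-operator on the highest vector\<close>

lemma h_weight_initial:
  assumes "i \<le> k" "k \<le> n"
  shows "h_weight {i+1..n} {1..k} = 2 * int k - int n - int i"
proof -
  have "{i+1..n} = {i+1..k} \<union> {k+1..n}" using assms by auto
  then have "h_weight {i+1..n} {1..k} = (\<Sum>j\<in>{i+1..k} \<union> {k+1..n}. if j \<in> {1..k} then 1 else -1)"
    unfolding h_weight_def by (rule arg_cong)
  also have "\<dots> = (\<Sum>j\<in>{i+1..k}. if j \<in> {1..k} then 1 else -1) + (\<Sum>j\<in>{k+1..n}. if j \<in> {1..k} then 1 else -1)"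
    by (rule sum.union_disjoint) auto
  also have "\<dots> = (\<Sum>j\<in>{i+1..k}. 1) + (\<Sum>j\<in>{k+1..n}. -1)"
    by (intro arg_cong2[where f="(+)"] sum.cong) auto
  finally show ?thesis using assms by simp
qed

text \<open>Sites are processed from \<open>n\<close> down to \<open>1\<close>. Once the auxiliary
  factor has taken a \<open>v_1\<close> from some site, all sites still to come carry
  \<open>v_1\<close>, and on \<open>v_1 \<otimes> v_1\<close> the R-matrix is the identity; the
  auxiliary factor never returns to \<open>v_2\<close>. Hence only diagonal entries contribute to
  \<open>L_22\<close>, with value \<open>1\<close> at the sites above \<open>k\<close>.\<close>

lemma L22_highest_coordinate:
  fixes lam w y c :: "'a::field" and z :: "nat \<Rightarrow> 'a"
  assumes k: "k \<le> n" and A: "A \<subseteq> {1..n}"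
  defines "d \<equiv> \<lambda>i. R_diag (lam - y * of_int (h_weight {i+1..n} {1..k})) (w - z i) y False"
  shows "L_entry n 2 2 lam w z y (\<lambda>A. if A = {1..k} then c else 0) A =
    (if A = {1..k} then (\<Prod>i\<in>{1..k}. d i) * c else 0)"
proof -
  define v where "v = aux_tensor 2 (\<lambda>A. if A = {1..k} then c else (0::'a))"
  define \<phi> where "\<phi> = (\<lambda>m. L_seg n lam w z y [m..<n+1] v)"
  \<comment> \<open>\<open>\<phi> m\<close> is the vector after sites \<open>n, ..., m\<close>. The
    second conjunct describes the part with \<open>v_1\<close> in the auxiliary factor: its support
    keeps \<open>v_1\<close> at all unprocessed sites, which rules out a transition back to
    \<open>v_2\<close>.\<close>
  have "\<forall>A\<subseteq>{0..n}. (0 \<notin> A \<longrightarrow> \<phi> m A = (if A = {1..k} then (\<Prod>i\<in>{m..k}. d i) * c else 0)) \<and>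
      (0 \<in> A \<longrightarrow> \<phi> m A \<noteq> 0 \<longrightarrow> m \<le> k \<and> {1..<m} \<subseteq> A)" if "1 \<le> m" "m \<le> n + 1" for m
    using that(2,1)
  proof (induction rule: inc_induct)
    case base
    show ?case using k by (auto simp: \<phi>_def L_seg_def v_def aux_tensor_def tensor_index_def)
  next
    case (step m)
    have IH0: "\<phi> (Suc m) A = (if A = {1..k} then (\<Prod>i\<in>{Suc m..k}. d i) * c else 0)"
      if "A \<subseteq> {0..n}" "0 \<notin> A" for A using step that by simp
    have IH1: "Suc m \<le> k \<and> {1..<Suc m} \<subseteq> A" if "A \<subseteq> {0..n}" "0 \<in> A" "\<phi> (Suc m) A \<noteq> 0" for A
      using step that by simp
    have m: "1 \<le> m" "m \<le> n" using step by auto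
    have \<phi>: "\<phi> m = R_op n 0 m {m+1..n} lam (w - z m) y (\<phi> (Suc m))"
      using m by (simp add: \<phi>_def L_seg_def upt_rec[of m] del: upt_Suc)
    show ?case
    proof (intro allI impI conjI)
      fix A assume A: "A \<subseteq> {0..n}" "0 \<notin> A"
      show "\<phi> m A = (if A = {1..k} then (\<Prod>i\<in>{m..k}. d i) * c else 0)"
      proof (cases "m \<in> A")
        case False
        then have "\<phi> m A = \<phi> (Suc m) A" unfolding \<phi> using A m by (subst R_op_alt) auto
        moreover have "{m..k} = {Suc m..k}" if "A = {1..k}" using that False m by auto
        ultimately show ?thesis using IH0[OF A] by simp
      next
        case True
        have "\<phi> (Suc m) (swap_mem 0 m A) = 0"
          by (rule ccontr, drule IH1[rotated 2]) (use A True m in \<open>auto simp: swap_mem_def\<close>)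
        then have *: "\<phi> m A = R_diag (lam - y * of_int (h_weight {m+1..n} A)) (w - z m) y False * \<phi> (Suc m) A"
          unfolding \<phi> using A m True by (subst R_op_alt) auto
        show ?thesis
        proof (cases "A = {1..k}")
          case True
          with \<open>m \<in> A\<close> have "prod d {m..k} = d m * prod d {Suc m..k}"
            by (intro prod.atLeast_Suc_atMost) auto
          moreover have "\<phi> m A = d m * (prod d {Suc m..k} * c)"
            using * IH0[OF A] True by (simp add: d_def)
          ultimately show ?thesis using True by (simp add: mult.assoc)
        qed (use * IH0[OF A] in simp)
      qed
    next
      fix A assume A: "A \<subseteq> {0..n}" "0 \<in> A" "\<phi> m A \<noteq> 0"
      have "m \<le> k \<and> {1..<m} \<subseteq> A"
      proof (cases "m \<in> A")
        case True
        then have "\<phi> m A = \<phi> (Suc m) A" unfolding \<phi> using A m by (subst R_op_alt) auto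
        then show ?thesis using IH1[OF A(1,2)] A(3) by auto
      next
        case False
        have "m \<in> {1..<Suc m}" using m by simp
        then have "\<phi> (Suc m) A = 0" using IH1[OF A(1,2)] False by blast
        moreover have "\<phi> m A = R_diag (lam - y * of_int (h_weight {m+1..n} A)) (w - z m) y True * \<phi> (Suc m) A
            + R_off (lam - y * of_int (h_weight {m+1..n} A)) (w - z m) y True * \<phi> (Suc m) (swap_mem 0 m A)"
          unfolding \<phi> using A(1,2) m False by (subst R_op_alt) auto
        ultimately have "\<phi> (Suc m) (swap_mem 0 m A) \<noteq> 0" using A(3) by auto
        moreover have "swap_mem 0 m A = insert m (A - {0})" "insert m (A - {0}) \<subseteq> {0..n}" "0 \<notin> insert m (A - {0})"
          using A m by (auto simp: swap_mem_def)
        ultimately have eq: "insert m (A - {0}) = {1..k}" using IH0 by (metis (no_types, lifting))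
        have "m \<le> k" using eq m by (metis insertI1 atLeastAtMost_iff)
        moreover have "x \<in> A" if "x \<in> {1..<m}" for x
        proof -
          have "x \<in> insert m (A - {0})" unfolding eq using that \<open>m \<le> k\<close> by auto
          then show ?thesis using that by auto
        qed
        ultimately show ?thesis by blast
      qed
      then show "m \<le> k" "{1..<m} \<subseteq> A" by auto
    qed
  qed
  note inv = this
  have A0: "A \<subseteq> {0..n}" "0 \<notin> A" using A by auto
  have "\<phi> 1 A = (if A = {1..k} then (\<Prod>i\<in>{1..k}. d i) * c else 0)"
    using inv[OF order_refl le_add2, rule_format, OF A0(1)] A0(2) by blast
  moreover have "L_entry n 2 2 lam w z y (\<lambda>A. if A = {1..k} then c else 0) A = \<phi> 1 A"
    unfolding L_entry_def L_op_eq_seg \<phi>_def v_def using A by (simp del: upt_Suc)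
  ultimately show ?thesis by (rule trans[rotated])
qed

text \<open>At site \<open>i\<close> the dynamical parameter is \<open>l i\<close>, and the
  numerator \<open>l i - y\<close> of the diagonal entry is the parameter \<open>l (i - 1)\<close>
  of the site before. The surviving quotient \<open>l 0 / l k\<close> is what the shift of
  \<open>\<lambda>\<close> in the coefficient must cancel.\<close>

lemma prod_R_diag_telescope:
  fixes lam w y :: "'a::field" and z :: "nat \<Rightarrow> 'a"
  assumes k: "k \<le> n" and gen: "\<And>l::int. lam + of_int l * y \<noteq> 0"
  shows "(\<Prod>i\<in>{1..k}. R_diag (lam - y * of_int (h_weight {i+1..n} {1..k})) (w - z i) y False) =
    (lam + (of_nat n - 2 * of_nat k) * y) / (lam + (of_nat n - of_nat k) * y) *
    (\<Prod>i\<in>{1..k}. (w - z i) / (w - z i - y))"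
proof -
  define l where "l = (\<lambda>i. lam + (of_nat n - 2 * of_nat k + of_nat i) * y)"
  have l: "l i \<noteq> 0" for i
    using gen[of "int n - 2 * int k + int i"] by (simp add: l_def)
  have "(\<Prod>i\<in>{1..k}. R_diag (lam - y * of_int (h_weight {i+1..n} {1..k})) (w - z i) y False) =
     (\<Prod>i\<in>{1..k}. l (i - 1) / l i * ((w - z i) / (w - z i - y)))"
  proof (intro prod.cong refl)
    fix i assume i: "i \<in> {1..k}"
    have "lam - y * of_int (h_weight {i+1..n} {1..k}) = l i"
      using i k by (subst h_weight_initial) (auto simp: l_def algebra_simps)
    moreover have "l i - y = l (i - 1)"
      using i by (auto simp: l_def algebra_simps of_nat_diff)
    ultimately show "R_diag (lam - y * of_int (h_weight {i+1..n} {1..k})) (w - z i) y False =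
        l (i - 1) / l i * ((w - z i) / (w - z i - y))" by (simp add: R_diag_def)
  qed
  also have "\<dots> = (\<Prod>i\<in>{1..k}. l (i - 1) / l i) * (\<Prod>i\<in>{1..k}. (w - z i) / (w - z i - y))"
    by (rule prod.distrib)
  \<comment> \<open>This \<open>k\<close> is a fresh upper bound for the induction; the
    \<open>k\<close> inside \<open>l\<close> stays fixed.\<close>
  also have "(\<Prod>i\<in>{1..k}. l (i - 1) / l i) = l 0 / l k" for k
    using l by (induction k) (auto simp: prod.cl_ivl_Suc)
  finally show ?thesis by (simp add: l_def algebra_simps)
qed

section \<open>Weight functions\<close>

lemma nth_elem_bij_betw:
  assumes "finite I"
  shows "bij_betw (nth_elem I) {1..card I} I"
proof -
  have "bij_betw ((!) (sorted_list_of_set I)) {..<card I} I"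
    using assms by (intro bij_betw_nth) auto
  moreover have "bij_betw (\<lambda>r. r - 1) {1..card I} {..<card I}"
    by (rule bij_betw_byWitness[where f' = Suc]) auto
  ultimately have "bij_betw ((!) (sorted_list_of_set I) \<circ> (\<lambda>r. r - 1)) {1..card I} I"
    by (rule bij_betw_trans[rotated])
  then show ?thesis by (simp add: nth_elem_def[abs_def] comp_def)
qed

lemma nth_elem_in: "finite I \<Longrightarrow> r \<in> {1..card I} \<Longrightarrow> nth_elem I r \<in> I"
  using nth_elem_bij_betw bij_betwE by blast

lemma nth_elem_strict_mono:
  assumes "finite I" "r \<in> {1..card I}" "r' \<in> {1..card I}"
  shows "nth_elem I r < nth_elem I r' \<longleftrightarrow> r < r'"
proof -
  have *: "nth_elem I r < nth_elem I r'" if "r < r'" "r \<in> {1..card I}" "r' \<in> {1..card I}" for r r'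
    unfolding nth_elem_def using that assms(1)
    by (intro sorted_wrt_nth_less[OF strict_sorted_list_of_set]) auto
  show ?thesis
    using *[OF _ assms(2,3)] *[OF _ assms(3,2)] by (cases r r' rule: linorder_cases) (auto simp: order.asym)
qed

lemma nth_elem_image:
  assumes "finite I" "strict_mono_on I f" "r \<in> {1..card I}"
  shows "nth_elem (f ` I) r = f (nth_elem I r)"
proof -
  have "sorted_wrt (<) (map f (sorted_list_of_set I))"
    unfolding sorted_wrt_map
    by (rule sorted_wrt_mono_rel[OF _ strict_sorted_list_of_set])
      (use assms in \<open>auto simp: strict_mono_on_def\<close>)
  then have "sorted_list_of_set (f ` I) = map f (sorted_list_of_set I)"
    using assms(1) by (intro strict_sorted_equal) auto
  moreover have "r - 1 < length (sorted_list_of_set I)" using assms by auto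
  ultimately show ?thesis by (simp add: nth_elem_def)
qed

text \<open>The exponent in the weight functions is the same quantity as the dynamical weight in the
  R-matrix; this is why their parameters can match at all.\<close>

lemma w_exp_eq_h_weight: "w_exp n i J = h_weight {i+1..n} J"
proof -
  have "h_weight {i+1..n} J = (\<Sum>j\<in>{i+1..n} \<inter> J. 1) + (\<Sum>j\<in>{i+1..n} - J. -1)"
    unfolding h_weight_def by (subst sum.Int_Diff[of _ _ J]) auto
  moreover have "{j\<in>{1..n}. j > i \<and> j \<in> J} = {i+1..n} \<inter> J" "{j\<in>{1..n}. j > i \<and> j \<notin> J} = {i+1..n} - J"
    by auto
  ultimately show ?thesis by (simp add: w_exp_def)
qed

text \<open>The product of the \<open>l_factor\<close>s of one row, with \<open>t_r\<close> and
  \<open>i_r\<close> as independent arguments \<open>u\<close> and \<open>i\<close>, so that rows of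
  different index sets can be compared.\<close>

definition weight_row :: "nat \<Rightarrow> nat set \<Rightarrow> 'a::field \<Rightarrow> (nat \<Rightarrow> 'a) \<Rightarrow> 'a \<Rightarrow> 'a \<Rightarrow> nat \<Rightarrow> 'a" where
  "weight_row n J \<mu> z y u i = (\<Prod>a\<in>{1..n}. if a < i then u - z a + y
     else if a = i then \<mu> + u - z a - of_int (w_exp n a J) * y else u - z a)"

definition pair_factor :: "nat \<Rightarrow> 'a::field \<Rightarrow> (nat \<Rightarrow> 'a) \<Rightarrow> 'a" where
  "pair_factor k y t = (\<Prod>b\<in>{1..k}. \<Prod>a\<in>{1..<b}. (t a - t b + y) / (t a - t b))"

definition weight_term :: "nat \<Rightarrow> nat set \<Rightarrow> 'a::field \<Rightarrow> (nat \<Rightarrow> 'a) \<Rightarrow> (nat \<Rightarrow> 'a) \<Rightarrow> 'a \<Rightarrow> 'a" where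
  "weight_term n J \<mu> t z y =
     (\<Prod>r\<in>{1..card J}. weight_row n J \<mu> z y (t r) (nth_elem J r)) * pair_factor (card J) y t"

lemma W_fun_alt:
  "W_fun n J \<mu> t z y = y ^ card J * (\<Sum>\<pi> | \<pi> permutes {1..card J}. weight_term n J \<mu> (t \<circ> \<pi>) z y)"
  by (simp add: W_fun_def Let_def weight_term_def weight_row_def pair_factor_def l_factor_def comp_def)

text \<open>Both \<open>b\<close> and \<open>b + 1\<close> lie on the same side of \<open>i\<close>,
  so the row is symmetric in \<open>z_b\<close> and \<open>z_(b+1)\<close>.\<close>

lemma weight_row_swap_other:
  fixes z :: "nat \<Rightarrow> 'a::field" and b n :: nat
  defines "s \<equiv> transpose b (b + 1)"
  assumes b: "1 \<le> b" "b + 1 \<le> n" and i: "i \<noteq> b" "i \<noteq> b + 1" and w: "w_exp n i J' = w_exp n i J"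
  shows "weight_row n J' \<mu> (z \<circ> s) y u i = weight_row n J \<mu> z y u i"
proof -
  have s: "s permutes {1..n}" unfolding s_def using b by (intro permutes_swap_id) auto
  have lt: "s a < i \<longleftrightarrow> a < i" "s a = i \<longleftrightarrow> a = i" "s i = i" for a
    using i by (auto simp: s_def Transposition.transpose_def)
  show ?thesis
    unfolding weight_row_def
    by (subst prod.permute[OF s, of "\<lambda>a. if a < i then u - z a + y
      else if a = i then \<mu> + u - z a - of_int (w_exp n a J) * y else u - z a"])
      (auto intro!: prod.cong simp: lt w)
qed

text \<open>The common factor of the rows \<open>b\<close> and \<open>b + 1\<close>: for every other
  \<open>a\<close>, being below \<open>b\<close> and being below \<open>b + 1\<close>
  coincide.\<close>

definition row_rest :: "nat \<Rightarrow> nat \<Rightarrow> (nat \<Rightarrow> 'a::field) \<Rightarrow> 'a \<Rightarrow> 'a \<Rightarrow> 'a" where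
  "row_rest n b z y u = (\<Prod>a\<in>{1..n} - {b, b + 1}. if a < b then u - z a + y else u - z a)"

lemma row_rest_swap: "row_rest n b (z \<circ> transpose b (b + 1)) y u = row_rest n b z y u"
  unfolding row_rest_def by (intro prod.cong) auto

lemma weight_row_split:
  assumes b: "1 \<le> b" "b + 1 \<le> n"
  shows "weight_row n J \<mu> z y u b =
      (\<mu> + u - z b - of_int (w_exp n b J) * y) * (u - z (b + 1)) * row_rest n b z y u"
    and "weight_row n J \<mu> z y u (b + 1) =
      (u - z b + y) * (\<mu> + u - z (b + 1) - of_int (w_exp n (b + 1) J) * y) * row_rest n b z y u"
proof -
  have split: "prod f {1..n} = f b * f (b + 1) * prod f ({1..n} - {b, b + 1})" for f :: "nat \<Rightarrow> 'a"
  proof -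
    have "prod f {1..n} = prod f {b, b + 1} * prod f ({1..n} - {b, b + 1})"
      by (rule prod.subset_diff[THEN trans[OF _ mult.commute]]) (use b in auto)
    then show ?thesis by simp
  qed
  show "weight_row n J \<mu> z y u b =
      (\<mu> + u - z b - of_int (w_exp n b J) * y) * (u - z (b + 1)) * row_rest n b z y u"
    unfolding weight_row_def split row_rest_def by (rule arg_cong2[where f="(*)"], simp, rule prod.cong, auto)
  show "weight_row n J \<mu> z y u (b + 1) =
      (u - z b + y) * (\<mu> + u - z (b + 1) - of_int (w_exp n (b + 1) J) * y) * row_rest n b z y u"
    unfolding weight_row_def split row_rest_def by (rule arg_cong2[where f="(*)"], simp, rule prod.cong, auto)
qed

definition pair_factor_rest :: "nat \<Rightarrow> nat \<Rightarrow> 'a::field \<Rightarrow> (nat \<Rightarrow> 'a) \<Rightarrow> 'a" where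
  "pair_factor_rest k r y t =
     (\<Prod>(b, a)\<in>(SIGMA b:{1..k}. {1..<b}) - {(r + 1, r)}. (t a - t b + y) / (t a - t b))"

lemma pair_factor_split:
  assumes "1 \<le> r" "r + 1 \<le> k"
  shows "pair_factor k y t = (t r - t (r + 1) + y) / (t r - t (r + 1)) * pair_factor_rest k r y t"
proof -
  have "(r + 1, r) \<in> (SIGMA b:{1..k}. {1..<b})" using assms by simp
  then show ?thesis
    unfolding pair_factor_def pair_factor_rest_def
    by (subst prod.Sigma, simp, simp, subst prod.remove[of _ "(r + 1, r)"]) auto
qed

text \<open>An adjacent transposition reverses the order of no pair except
  \<open>(r, r + 1)\<close>, so it permutes the remaining factors.\<close>

lemma pair_factor_rest_swap:
  assumes "1 \<le> r" "r + 1 \<le> k"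
  shows "pair_factor_rest k r y (t \<circ> transpose r (r + 1)) = pair_factor_rest k r y t"
proof -
  define P where "P = (SIGMA b:{1..k}. {1..<b}) - {(r + 1, r)}"
  have *: "map_prod (transpose r (r + 1)) (transpose r (r + 1)) p \<in> P" if "p \<in> P" for p
    using that assms by (cases p) (auto simp: P_def Transposition.transpose_def)
  show ?thesis
    unfolding pair_factor_rest_def P_def[symmetric]
    by (rule prod.reindex_bij_witness[of _ "map_prod (transpose r (r + 1)) (transpose r (r + 1))"
          "map_prod (transpose r (r + 1)) (transpose r (r + 1))"]) (use * in auto)
qed

text \<open>What is left of the rows \<open>b\<close> and \<open>b + 1\<close> after their common
  factor is removed, with \<open>x = z_b\<close> and \<open>x' = z_(b+1)\<close>: the R-matrix
  relates quadratic polynomials in the single variable \<open>u\<close>.\<close>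

lemma exchange_scalar:
  fixes l x x' y u :: "'a::field"
  assumes "l \<noteq> 0" "x' - x - y \<noteq> 0"
  shows "(u - l - x + y) * (u - x') =
      R_diag l (x' - x) y False * ((u - x' + y) * (u - l - x)) + R_off l (x' - x) y False * ((u - l - x' + y) * (u - x))"
    (is ?A)
  and "(u - x + y) * (u - l - x') =
      R_diag l (x' - x) y True * ((u - l - x' + y) * (u - x)) + R_off l (x' - x) y True * ((u - x' + y) * (u - l - x))"
    (is ?B)
proof -
  define v where "v = x' - x - y"
  have v: "v \<noteq> 0" using assms by (simp add: v_def)
  show ?A unfolding R_diag_def R_off_def v_def[symmetric] if_False
    using v assms(1) by (simp add: divide_simps) (use v_def in algebra)
  show ?B unfolding R_diag_def R_off_def v_def[symmetric] if_True
    using v assms(1) by (simp add: divide_simps) (use v_def in algebra)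
qed

lemma weight_row_exchange:
  fixes \<mu> y u :: "'a::field" and z :: "nat \<Rightarrow> 'a" and b n :: nat
  defines "s \<equiv> transpose b (b + 1)"
  assumes b: "1 \<le> b" "b + 1 \<le> n" and one: "(b \<in> J) \<noteq> (b + 1 \<in> J)"
    and i: "i \<in> {b, b + 1}" "i \<in> J"
  defines "l \<equiv> of_int (h_weight {b+2..n} J) * y - \<mu>"
  assumes l: "l \<noteq> 0" and zz: "z (b + 1) - z b - y \<noteq> 0"
  shows "weight_row n J \<mu> z y u i =
      R_diag l (z (b + 1) - z b) y (b + 1 \<in> J) * weight_row n (s ` J) \<mu> (z \<circ> s) y u (s i) +
      R_off l (z (b + 1) - z b) y (b + 1 \<in> J) * weight_row n J \<mu> (z \<circ> s) y u i"
proof -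
  define h where "h = of_int (h_weight {b+2..n} J) * y"
  define X where "X = z (b + 1) - z b - y"
  have s: "s b = b + 1" "s (b + 1) = b" by (simp_all add: s_def)
  have mem: "b \<in> s ` J \<longleftrightarrow> b + 1 \<in> J" "b + 1 \<in> s ` J \<longleftrightarrow> b \<in> J" "\<And>j. j \<ge> b + 2 \<Longrightarrow> j \<in> s ` J \<longleftrightarrow> j \<in> J"
    unfolding s_def in_transpose_image_iff by (simp_all add: Transposition.transpose_def)
  have hs: "h_weight {b+2..n} (s ` J) = h_weight {b+2..n} J"
    by (rule h_weight_cong, rule mem(3)) simp
  have w1: "w_exp n (b + 1) J = h_weight {b+2..n} J" "w_exp n (b + 1) (s ` J) = h_weight {b+2..n} J"
    unfolding w_exp_eq_h_weight using hs by simp_all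
  have "{b+1..n} = insert (b + 1) {b+2..n}" using b by auto
  then have wb: "w_exp n b J' = (if b + 1 \<in> J' then 1 else -1) + h_weight {b+2..n} J'" for J'
    unfolding w_exp_eq_h_weight by (simp add: h_weight_def)
  have w2: "w_exp n b J = (if b + 1 \<in> J then 1 else -1) + h_weight {b+2..n} J"
    "w_exp n b (s ` J) = (if b \<in> J then 1 else -1) + h_weight {b+2..n} J"
    unfolding wb hs mem by (rule refl)+
  \<comment> \<open>This dictates the choice of \<open>l\<close>: the diagonal factor of a row
    becomes \<open>u - l - x\<close>, up to a shift by \<open>y\<close> that occurs at site
    \<open>b\<close> when \<open>b + 1\<close> is absent.\<close>
  have e: "\<mu> + u - x - of_int (- 1 + h_weight {b+2..n} J) * y = u - l - x + y"
    "\<mu> + u - x - of_int (h_weight {b+2..n} J) * y = u - l - x" for x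
    by (simp_all add: l_def algebra_simps)
  note rest = row_rest_swap[of n b z y u, folded s_def]
  have mult: "p = d * q + c * q' \<Longrightarrow> p * x = d * (q * x) + c * (q' * x)" for p d q c q' x :: 'a
    by (simp add: algebra_simps)
  consider "i = b" "b \<in> J" "b + 1 \<notin> J" | "i = b + 1" "b \<notin> J" "b + 1 \<in> J" using i one by auto
  then show ?thesis
  proof cases
    case 1
    have f: "weight_row n J \<mu> z y u i = (u - l - z b + y) * (u - z (b + 1)) * row_rest n b z y u"
      "weight_row n (s ` J) \<mu> (z \<circ> s) y u (s i) = (u - z (b + 1) + y) * (u - l - z b) * row_rest n b z y u"
      "weight_row n J \<mu> (z \<circ> s) y u i = (u - l - z (b + 1) + y) * (u - z b) * row_rest n b z y u"
      unfolding 1(1) s weight_row_split[OF b] rest w1 w2 comp_apply if_not_P[OF 1(3)] e by (rule refl)+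
    from mult[OF exchange_scalar(1)[OF l zz, of u], of "row_rest n b z y u"] show ?thesis
      unfolding f using 1(3) by (simp only: simp_thms)
  next
    case 2
    have f: "weight_row n J \<mu> z y u i = (u - z b + y) * (u - l - z (b + 1)) * row_rest n b z y u"
      "weight_row n (s ` J) \<mu> (z \<circ> s) y u (s i) = (u - l - z (b + 1) + y) * (u - z b) * row_rest n b z y u"
      "weight_row n J \<mu> (z \<circ> s) y u i = (u - z (b + 1) + y) * (u - l - z b) * row_rest n b z y u"
      unfolding 2(1) s weight_row_split[OF b] rest w1 w2 comp_apply if_not_P[OF 2(2)] e by (rule refl)+
    from mult[OF exchange_scalar(2)[OF l zz, of u], of "row_rest n b z y u"] show ?thesis
      unfolding f using 2(3) by (simp only: simp_thms)
  qed
qed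

lemma nth_elem_surj:
  assumes "finite I" "i \<in> I"
  obtains r where "r \<in> {1..card I}" "nth_elem I r = i"
proof -
  have "i \<in> nth_elem I ` {1..card I}"
    using bij_betw_imp_surj_on[OF nth_elem_bij_betw[OF assms(1)]] assms(2) by simp
  then show ?thesis using that by (elim imageE) simp
qed

lemma nth_elem_eq_iff:
  assumes "finite I" "r \<in> {1..card I}" "r' \<in> {1..card I}"
  shows "nth_elem I r = nth_elem I r' \<longleftrightarrow> r = r'"
  using bij_betw_imp_inj_on[OF nth_elem_bij_betw[OF assms(1)]] assms(2,3) by (simp add: inj_on_eq_iff)

lemma h_weight_image:
  assumes "inj f"
  shows "h_weight (f ` S) (f ` A) = h_weight S A"
  unfolding h_weight_def using assms by (subst sum.reindex) (auto simp: inj_image_mem_iff inj_on_def)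

text \<open>Only \<open>b\<close> and \<open>b + 1\<close> change their relative order. So
  \<open>s\<close> carries the \<open>r\<close>-th element of \<open>J\<close> to the
  \<open>r\<close>-th element of its image, and weight functions of the two sets match row by
  row.\<close>

lemma strict_mono_on_transpose:
  fixes b :: nat
  assumes "b \<notin> J \<or> b + 1 \<notin> J"
  shows "strict_mono_on J (transpose b (b + 1))"
  unfolding strict_mono_on_def
proof (intro allI impI)
  fix r r' assume "r \<in> J \<and> r' \<in> J \<and> r < r'"
  then show "transpose b (b + 1) r < transpose b (b + 1) r'"
    using assms by (cases "r = b"; cases "r = b + 1"; cases "r' = b"; cases "r' = b + 1")
      (auto simp: Transposition.transpose_def)
qed

text \<open>In each summand exactly one row, the one at position \<open>r0\<close>, belongs to
  \<open>b\<close> or \<open>b + 1\<close>. The other rows are unaffected and the pair factors do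
  not contain \<open>z\<close>, so the relation for one row lifts to each summand and then to the
  sum.\<close>

lemma W_fun_exchange_one:
  fixes \<mu> y :: "'a::field" and t z :: "nat \<Rightarrow> 'a" and b n :: nat
  defines "s \<equiv> transpose b (b + 1)"
  assumes b: "1 \<le> b" "b + 1 \<le> n" and one: "(b \<in> J) \<noteq> (b + 1 \<in> J)" and J: "finite J"
  defines "l \<equiv> of_int (h_weight {b+2..n} J) * y - \<mu>"
  assumes l: "l \<noteq> 0" and zz: "z (b + 1) - z b - y \<noteq> 0"
  shows "W_fun n J \<mu> t z y =
      R_diag l (z (b + 1) - z b) y (b + 1 \<in> J) * W_fun n (s ` J) \<mu> t (z \<circ> s) y +
      R_off l (z (b + 1) - z b) y (b + 1 \<in> J) * W_fun n J \<mu> t (z \<circ> s) y"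
proof -
  define k where "k = card J"
  have inj: "inj s" by (simp add: s_def)
  have k': "card (s ` J) = k" unfolding k_def by (intro card_image inj_on_subset[OF inj]) simp
  have nth: "nth_elem (s ` J) r = s (nth_elem J r)" if "r \<in> {1..k}" for r
    unfolding s_def using that one J by (intro nth_elem_image strict_mono_on_transpose) (auto simp: k_def)
  obtain i where i: "i \<in> J" "i \<in> {b, b + 1}" using one by auto
  then obtain r0 where r0: "r0 \<in> {1..k}" "nth_elem J r0 = i"
    using nth_elem_surj[OF J] unfolding k_def by metis
  have w: "w_exp n j (s ` J) = w_exp n j J" if "j \<noteq> b" "j \<noteq> b + 1" for j
  proof -
    have "s ` {j+1..n} = {j+1..n}"
      unfolding s_def using that b by (intro transpose_image_eq) auto
    then show ?thesis unfolding w_exp_eq_h_weight using h_weight_image[OF inj, of "{j+1..n}" J] by simp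
  qed
  have other: "weight_row n (s ` J) \<mu> (z \<circ> s) y u (nth_elem (s ` J) r) = weight_row n J \<mu> z y u (nth_elem J r)"
    "weight_row n J \<mu> (z \<circ> s) y u (nth_elem J r) = weight_row n J \<mu> z y u (nth_elem J r)"
    if "r \<in> {1..k} - {r0}" for r u
  proof -
    have "nth_elem J r \<noteq> i" using nth_elem_eq_iff[OF J, of r r0] that r0 by (simp add: k_def)
    moreover have "nth_elem J r \<in> J" using that J by (intro nth_elem_in) (auto simp: k_def)
    ultimately have ne: "nth_elem J r \<noteq> b" "nth_elem J r \<noteq> b + 1" using i one by auto
    then have "s (nth_elem J r) = nth_elem J r" by (simp add: s_def)
    then have eq: "nth_elem (s ` J) r = nth_elem J r" using nth that by simp
    show "weight_row n (s ` J) \<mu> (z \<circ> s) y u (nth_elem (s ` J) r) = weight_row n J \<mu> z y u (nth_elem J r)"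
      unfolding eq unfolding s_def by (rule weight_row_swap_other[OF b ne w[OF ne, unfolded s_def]])
    show "weight_row n J \<mu> (z \<circ> s) y u (nth_elem J r) = weight_row n J \<mu> z y u (nth_elem J r)"
      unfolding s_def by (rule weight_row_swap_other[OF b ne refl])
  qed
  have "weight_term n J \<mu> u z y =
      R_diag l (z (b + 1) - z b) y (b + 1 \<in> J) * weight_term n (s ` J) \<mu> u (z \<circ> s) y +
      R_off l (z (b + 1) - z b) y (b + 1 \<in> J) * weight_term n J \<mu> u (z \<circ> s) y" for u
  proof -
    define C where "C = (\<Prod>r\<in>{1..k} - {r0}. weight_row n J \<mu> z y (u r) (nth_elem J r))"
    have 1: "(\<Prod>r\<in>{1..k}. weight_row n J \<mu> z y (u r) (nth_elem J r)) = weight_row n J \<mu> z y (u r0) i * C"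
      unfolding C_def using r0 by (subst prod.remove[of _ r0]) auto
    have 2: "(\<Prod>r\<in>{1..k}. weight_row n (s ` J) \<mu> (z \<circ> s) y (u r) (nth_elem (s ` J) r)) =
        weight_row n (s ` J) \<mu> (z \<circ> s) y (u r0) (s i) * C"
      unfolding C_def using r0 other(1) by (subst prod.remove[of _ r0]) (auto simp: nth)
    have 3: "(\<Prod>r\<in>{1..k}. weight_row n J \<mu> (z \<circ> s) y (u r) (nth_elem J r)) =
        weight_row n J \<mu> (z \<circ> s) y (u r0) i * C"
      unfolding C_def using r0 other(2) by (subst prod.remove[of _ r0]) auto
    have "weight_row n J \<mu> z y (u r0) i =
      R_diag l (z (b + 1) - z b) y (b + 1 \<in> J) * weight_row n (s ` J) \<mu> (z \<circ> s) y (u r0) (s i) +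
      R_off l (z (b + 1) - z b) y (b + 1 \<in> J) * weight_row n J \<mu> (z \<circ> s) y (u r0) i"
      unfolding s_def l_def by (rule weight_row_exchange[OF b one i(2,1) l[unfolded l_def] zz])
    then show ?thesis
      unfolding weight_term_def k' k_def[symmetric] 1 2 3 by (simp add: algebra_simps)
  qed
  then show ?thesis
    unfolding W_fun_alt k' k_def[symmetric] by (simp add: sum.distrib sum_distrib_left algebra_simps)
qed

text \<open>If both sites belong to \<open>J\<close>, a single summand of the weight function is not symmetric in the two
  \<open>z\<close>'s; only the sum of the terms for \<open>\<pi>\<close> and \<open>\<pi> \<circ> (r, r+1)\<close> is. At \<open>u = v\<close> both sides are \<open>0\<close> since
  \<open>x / 0 = 0\<close>.\<close>

lemma exchange_scalar_pair:
  fixes u v x x' y c R R' :: "'a::field"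
  defines "F \<equiv> \<lambda>u v x x'. (c - y + u - x) * (u - x') * ((v - x + y) * (c + v - x'))"
  shows "(u - v + y) / (u - v) * (F u v x x' - F u v x' x) = - ((v - u + y) / (v - u) * (F v u x x' - F v u x' x))"
proof (cases "u = v")
  case False
  then have "u - v \<noteq> 0" "v - u \<noteq> 0" by auto
  moreover have "(u - v + y) * (F u v x x' - F u v x' x) * (v - u) = - ((v - u + y) * (F v u x x' - F v u x' x)) * (u - v)"
    unfolding F_def by algebra
  ultimately show ?thesis by (simp add: divide_simps mult_ac)
qed simp

lemma W_fun_exchange_both:
  fixes \<mu> y :: "'a::field" and t z :: "nat \<Rightarrow> 'a" and b n :: nat
  defines "s \<equiv> transpose b (b + 1)"
  assumes two: "(2::'a) \<noteq> 0" and b: "1 \<le> b" "b + 1 \<le> n" and both: "(b \<in> J) = (b + 1 \<in> J)" and J: "finite J"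
  shows "W_fun n J \<mu> t (z \<circ> s) y = W_fun n J \<mu> t z y"
proof -
  define k where "k = card J"
  have row: "weight_row n J \<mu> (z \<circ> s) y u j = weight_row n J \<mu> z y u j" if "j \<noteq> b" "j \<noteq> b + 1" for j u
    unfolding s_def by (rule weight_row_swap_other[OF b that refl])
  show ?thesis
  proof (cases "b \<in> J")
    case False
    have "weight_row n J \<mu> (z \<circ> s) y u (nth_elem J r) = weight_row n J \<mu> z y u (nth_elem J r)" if "r \<in> {1..k}" for r u
    proof -
      have "nth_elem J r \<in> J" using that J by (intro nth_elem_in) (auto simp: k_def)
      then show ?thesis using False both by (intro row) auto
    qed
    then show ?thesis unfolding W_fun_alt weight_term_def k_def[symmetric] by (auto intro!: sum.cong prod.cong)
  next
    case True
    then have bJ: "b \<in> J" "b + 1 \<in> J" using both by auto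
    obtain r where r: "r \<in> {1..k}" "nth_elem J r = b" using nth_elem_surj[OF J bJ(1)] unfolding k_def by metis
    obtain r' where r': "r' \<in> {1..k}" "nth_elem J r' = b + 1" using nth_elem_surj[OF J bJ(2)] unfolding k_def by metis
    have lt: "r < r'" using nth_elem_strict_mono[OF J, of r r'] r r' by (simp add: k_def)
    \<comment> \<open>No element of \<open>J\<close> fits between \<open>b\<close> and
      \<open>b + 1\<close>, so their rows are adjacent and \<open>\<tau>\<close> reverses just one
      pair factor.\<close>
    have "r' = r + 1"
    proof (rule ccontr)
      assume "r' \<noteq> r + 1"
      then have q: "r < r + 1" "r + 1 < r'" "r + 1 \<in> {1..k}" using lt r' by auto
      then have "b < nth_elem J (r + 1)" "nth_elem J (r + 1) < b + 1"
        using nth_elem_strict_mono[OF J, of r "r + 1"] nth_elem_strict_mono[OF J, of "r + 1" r'] r r' by (auto simp: k_def)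
      then show False by simp
    qed
    note r' = r'[unfolded this]
    define \<tau> where "\<tau> = transpose r (r + 1)"
    have \<tau>: "\<tau> permutes {1..k}" unfolding \<tau>_def using r r' by (intro permutes_swap_id) auto
    define G :: "(nat \<Rightarrow> 'a) \<Rightarrow> 'a" where "G = pair_factor_rest k r y"
    have G: "pair_factor k y t = (t r - t (r + 1) + y) / (t r - t (r + 1)) * G t" for t
      unfolding G_def using r r' by (intro pair_factor_split) auto
    have G': "G (t \<circ> \<tau>) = G t" for t
      unfolding G_def \<tau>_def using r r' by (intro pair_factor_rest_swap) auto
    define C where "C = (\<lambda>u. \<Prod>q\<in>{1..k} - {r, r + 1}. weight_row n J \<mu> z y (u q) (nth_elem J q))"
    have C': "C (u \<circ> \<tau>) = C u" for u
      unfolding C_def \<tau>_def by (intro prod.cong) auto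
    have split: "prod f {1..k} = f r * f (r + 1) * prod f ({1..k} - {r, r + 1})" for f :: "nat \<Rightarrow> 'a"
    proof -
      have "prod f {1..k} = prod f {r, r + 1} * prod f ({1..k} - {r, r + 1})"
        by (rule prod.subset_diff[THEN trans[OF _ mult.commute]]) (use r r' in auto)
      then show ?thesis by simp
    qed
    have rest: "weight_row n J \<mu> (z \<circ> s) y u (nth_elem J q) = weight_row n J \<mu> z y u (nth_elem J q)"
      if "q \<in> {1..k} - {r, r + 1}" for q u
      using nth_elem_eq_iff[OF J, of q r] nth_elem_eq_iff[OF J, of q "r + 1"] that r r'
      by (intro row) (auto simp: k_def)
    define c where "c = \<mu> - of_int (w_exp n (b + 1) J) * y"
    have "{b+1..n} = insert (b + 1) {b+1+1..n}" using b by auto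
    then have wb: "w_exp n b J = 1 + w_exp n (b + 1) J"
      unfolding w_exp_eq_h_weight using bJ by (simp add: h_weight_def)
    define F where "F = (\<lambda>u v x x'. (c - y + u - x) * (u - x') * ((v - x + y) * (c + v - x')))"
    define E where "E = (\<lambda>u. row_rest n b z y (u r) * row_rest n b z y (u (r + 1)) * C u * G u)"
    have E': "E (u \<circ> \<tau>) = E u" for u unfolding E_def C' G' by (simp add: \<tau>_def)
    have e: "\<mu> + u - x - of_int (w_exp n b J) * y = c - y + u - x"
      "\<mu> + u - x - of_int (w_exp n (b + 1) J) * y = c + u - x" for u x
      by (simp_all add: wb c_def algebra_simps)
    have s: "s b = b + 1" "s (b + 1) = b" by (simp_all add: s_def)
    have C1: "(\<Prod>q\<in>{1..k} - {r, r + 1}. weight_row n J \<mu> z y (u q) (nth_elem J q)) = C u" for u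
      by (simp only: C_def)
    have term1: "weight_term n J \<mu> u z y = E u * ((u r - u (r + 1) + y) / (u r - u (r + 1)) * F (u r) (u (r + 1)) (z b) (z (b + 1)))" for u
      unfolding weight_term_def k_def[symmetric] split r(2) r'(2) weight_row_split[OF b] C1 G E_def F_def e
      by (simp only: mult_ac)
    have term2: "weight_term n J \<mu> u (z \<circ> s) y = E u * ((u r - u (r + 1) + y) / (u r - u (r + 1)) * F (u r) (u (r + 1)) (z (b + 1)) (z b))" for u
    proof -
      have C2: "(\<Prod>q\<in>{1..k} - {r, r + 1}. weight_row n J \<mu> (z \<circ> s) y (u q) (nth_elem J q)) = C u"
        unfolding C_def by (intro prod.cong rest refl)
      show ?thesis
        unfolding weight_term_def k_def[symmetric] split r(2) r'(2) weight_row_split[OF b] C2 G E_def F_def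
          comp_apply s e row_rest_swap[of n b z y, folded s_def]
        by (simp only: mult_ac)
    qed
    define D where "D = (\<lambda>u. weight_term n J \<mu> u z y - weight_term n J \<mu> u (z \<circ> s) y)"
    \<comment> \<open>The defect of symmetry changes sign when the variables of the two rows are
      interchanged. Summed over all permutations it therefore equals its own negative, and
      \<open>two\<close> makes it vanish.\<close>
    have anti: "D (u \<circ> \<tau>) = - D u" for u
    proof -
      have "D u = E u * ((u r - u (r + 1) + y) / (u r - u (r + 1)) *
          (F (u r) (u (r + 1)) (z b) (z (b + 1)) - F (u r) (u (r + 1)) (z (b + 1)) (z b)))" for u
        unfolding D_def term1 term2 by (simp only: right_diff_distrib)
      note d = this
      have \<tau>r: "\<tau> r = r + 1" "\<tau> (r + 1) = r" by (simp_all add: \<tau>_def)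
      have "(u r - u (r + 1) + y) / (u r - u (r + 1)) *
          (F (u r) (u (r + 1)) (z b) (z (b + 1)) - F (u r) (u (r + 1)) (z (b + 1)) (z b)) =
        - ((u (r + 1) - u r + y) / (u (r + 1) - u r) *
          (F (u (r + 1)) (u r) (z b) (z (b + 1)) - F (u (r + 1)) (u r) (z (b + 1)) (z b)))"
        unfolding F_def by (rule exchange_scalar_pair)
      then show ?thesis
        unfolding d[of u] d[of "u \<circ> \<tau>"] E' comp_apply \<tau>r by (simp only: mult_minus_right minus_minus)
    qed
    have "(\<Sum>\<pi> | \<pi> permutes {1..k}. D (t \<circ> \<pi>)) = (\<Sum>\<pi> | \<pi> permutes {1..k}. D (t \<circ> (\<pi> \<circ> \<tau>)))"
      by (rule sum_permutations_compose_right[OF \<tau>])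
    also have "\<dots> = - (\<Sum>\<pi> | \<pi> permutes {1..k}. D (t \<circ> \<pi>))"
      by (simp only: comp_assoc[symmetric] anti sum_negf)
    finally have "2 * (\<Sum>\<pi> | \<pi> permutes {1..k}. D (t \<circ> \<pi>)) = 0" by simp
    then have "(\<Sum>\<pi> | \<pi> permutes {1..k}. D (t \<circ> \<pi>)) = 0" using two by simp
    then show ?thesis
      unfolding W_fun_alt k_def[symmetric] D_def by (simp add: sum_subtractf)
  qed
qed

section \<open>Exchange relation for \<open>\<xi>_I\<close>\<close>

definition rev_set :: "nat \<Rightarrow> nat set \<Rightarrow> nat set" where
  "rev_set n A = {i \<in> {1..n}. n + 1 - i \<in> A}"

lemma W_minus_alt:
  "W_minus n A lam t z y = (- 1) ^ card A / e_fun (card A) t y *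
     W_fun n (rev_set n A) (- lam - of_int (int n - 2 * int (card A)) * y) t (\<lambda>i. z (n + 1 - i)) y"
  by (simp add: W_minus_def W_perm_fun_def rev_set_def Let_def)

lemma card_rev_set:
  assumes "A \<subseteq> {1..n}"
  shows "card (rev_set n A) = card A"
proof -
  have x: "1 \<le> x" "x \<le> n" "Suc n - (Suc n - x) = x" "1 \<le> Suc n - x" "Suc n - x \<le> n" if "x \<in> A" for x
  proof -
    have "x \<in> {1..n}" using assms that by blast
    then show "1 \<le> x" "x \<le> n" "Suc n - (Suc n - x) = x" "1 \<le> Suc n - x" "Suc n - x \<le> n" by auto
  qed
  have "bij_betw (\<lambda>i. n + 1 - i) (rev_set n A) A"
    by (rule bij_betw_byWitness[where f' = "\<lambda>i. n + 1 - i"]) (auto simp: rev_set_def x x(4)[simplified])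
  then show ?thesis by (rule bij_betw_same_card)
qed

lemma finite_rev_set [simp]: "finite (rev_set n A)"
  by (simp add: rev_set_def)

lemma W_fun_cong:
  assumes "\<And>r. r \<in> {1..card J} \<Longrightarrow> t r = t' r"
  shows "W_fun n J \<mu> t z y = W_fun n J \<mu> t' z y"
proof -
  have "weight_term n J \<mu> (t \<circ> \<pi>) z y = weight_term n J \<mu> (t' \<circ> \<pi>) z y" if "\<pi> permutes {1..card J}" for \<pi>
  proof -
    have "t (\<pi> r) = t' (\<pi> r)" if "r \<in> {1..card J}" for r
      by (rule assms) (use permutes_in_image[OF \<open>\<pi> permutes {1..card J}\<close>] that in blast)
    then show ?thesis unfolding weight_term_def pair_factor_def comp_apply
      by (intro arg_cong2[where f="(*)"] prod.cong refl) auto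
  qed
  then show ?thesis unfolding W_fun_alt by (auto intro!: sum.cong)
qed

lemma W_minus_cong:
  assumes "A \<subseteq> {1..n}" "\<And>r. r \<in> {1..card A} \<Longrightarrow> t r = t' r"
  shows "W_minus n A lam t z y = W_minus n A lam t' z y"
proof -
  have "e_fun (card A) t y = e_fun (card A) t' y"
    unfolding e_fun_def using assms(2) by (auto intro!: prod.cong)
  moreover have "W_fun n (rev_set n A) \<mu> t z' y = W_fun n (rev_set n A) \<mu> t' z' y" for \<mu> z'
    by (rule W_fun_cong, rule assms(2)) (simp add: card_rev_set[OF assms(1)])
  ultimately show ?thesis unfolding W_minus_alt by simp
qed

lemma h_weight_total:
  assumes "A \<subseteq> {1..n}"
  shows "h_weight {1..n} A = 2 * int (card A) - int n"
proof -
  have "h_weight {1..n} A = (\<Sum>j\<in>{1..n} \<inter> A. 1) + (\<Sum>j\<in>{1..n} - A. -1)"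
    unfolding h_weight_def by (subst sum.Int_Diff[of _ _ A]) auto
  moreover have "{1..n} \<inter> A = A" using assms by auto
  moreover have "card ({1..n} - A) = n - card A" "card A \<le> n"
    using assms card_mono[OF _ assms] by (simp_all add: card_Diff_subset finite_subset)
  ultimately show ?thesis by simp
qed

text \<open>Reversal turns the sites after the pair into those before it, and the pair itself has
  weight 0; the total weight \<open>2k - n\<close> converts left into right. This explains the
  argument \<open>-\<lambda> - (n-2k)y\<close> in \<open>W_minus\<close>: the constant absorbs the
  total weight and the sign the complement.\<close>

lemma h_weight_rev_set:
  assumes a: "1 \<le> a" "a + 1 \<le> n" and A: "A \<subseteq> {1..n}" and one: "(a \<in> A) \<noteq> (a + 1 \<in> A)"
  shows "h_weight {n - a + 2..n} (rev_set n A) = 2 * int (card A) - int n - h_weight {a+2..n} A"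
proof -
  have "h_weight {n - a + 2..n} (rev_set n A) = h_weight {1..<a} A"
    unfolding h_weight_def
    by (rule sum.reindex_bij_witness[where i = "\<lambda>j. n + 1 - j" and j = "\<lambda>j. n + 1 - j"])
      (use a A in \<open>auto simp: rev_set_def\<close>)
  moreover have "h_weight {1..n} A = h_weight {1..<a} A + h_weight {a+2..n} A"
  proof -
    have "{1..n} = {1..<a} \<union> ({a, a + 1} \<union> {a+2..n})" using a by auto
    then have "h_weight {1..n} A = h_weight ({1..<a} \<union> ({a, a + 1} \<union> {a+2..n})) A" by (rule arg_cong)
    also have "\<dots> = h_weight {1..<a} A + (h_weight {a, a + 1} A + h_weight {a+2..n} A)"
      unfolding h_weight_def by (subst sum.union_disjoint; (subst sum.union_disjoint)?; auto)
    finally show ?thesis using one by (auto simp: h_weight_def)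
  qed
  ultimately show ?thesis using h_weight_total[OF A] by simp
qed

lemma W_minus_exchange:
  fixes lam y :: "'a::field" and t z :: "nat \<Rightarrow> 'a" and a n :: nat
  defines "s \<equiv> transpose a (a + 1)"
  assumes two: "(2::'a) \<noteq> 0" and a: "1 \<le> a" "a + 1 \<le> n" and A: "A \<subseteq> {1..n}"
    and gen: "\<And>l::int. lam + of_int l * y \<noteq> 0" "z a - z (a + 1) - y \<noteq> 0"
  defines "h \<equiv> of_int (h_weight {a+2..n} A)"
  shows "W_minus n A lam t z y =
    (if (a \<in> A) = (a + 1 \<in> A) then W_minus n A lam t (z \<circ> s) y
     else R_diag (lam - y * h) (z a - z (a + 1)) y (a \<in> A) * W_minus n (s ` A) lam t (z \<circ> s) y +
          R_off (lam - y * h) (z a - z (a + 1)) y (a \<in> A) * W_minus n A lam t (z \<circ> s) y)"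
proof -
  \<comment> \<open>Reversal takes \<open>a + 1\<close> to \<open>b\<close> and \<open>a\<close> to
    \<open>b + 1\<close>, so the difference \<open>z' (b + 1) - z' b\<close> is again
    \<open>z a - z (a + 1)\<close>.\<close>
  define b where "b = n - a"
  define s' where "s' = transpose b (b + 1)"
  define z' where "z' = (\<lambda>i. z (n + 1 - i))"
  define B where "B = rev_set n A"
  have b: "1 \<le> b" "b + 1 \<le> n" using a by (auto simp: b_def)
  have nb: "n + 1 - b = a + 1" "n + 1 - (b + 1) = a" using a by (auto simp: b_def)
  have mem: "b \<in> B \<longleftrightarrow> a + 1 \<in> A" "b + 1 \<in> B \<longleftrightarrow> a \<in> A"
    unfolding B_def rev_set_def mem_Collect_eq nb using b by auto
  have zs: "(\<lambda>i. (z \<circ> s) (n + 1 - i)) = z' \<circ> s'"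
  proof
    fix i
    have "s (n + 1 - i) = n + 1 - s' i"
      using a by (auto simp: s_def s'_def b_def Transposition.transpose_def)
    then show "(z \<circ> s) (n + 1 - i) = (z' \<circ> s') i" by (simp add: z'_def)
  qed
  have revs: "rev_set n (s ` A) = s' ` B"
  proof (rule set_eqI)
    fix i
    have "i \<in> {1..n} \<and> s (n + 1 - i) \<in> A \<longleftrightarrow> s' i \<in> {1..n} \<and> n + 1 - s' i \<in> A"
      using a by (auto simp: s_def s'_def b_def Transposition.transpose_def)
    then show "i \<in> rev_set n (s ` A) \<longleftrightarrow> i \<in> s' ` B"
      by (simp add: B_def rev_set_def s_def s'_def in_transpose_image_iff)
  qed
  have cs: "card (s ` A) = card A" unfolding s_def by (rule card_image) simp
  have fB: "finite B" by (simp add: B_def)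
  note alt = W_minus_alt[of n _ lam t _ y]
  show ?thesis
  proof (cases "(a \<in> A) = (a + 1 \<in> A)")
    case True
    then show ?thesis
      unfolding alt zs using W_fun_exchange_both[OF two b _ fB] mem
      by (simp add: z'_def[symmetric] B_def[symmetric] s'_def del: One_nat_def)
  next
    case False
    define \<mu> where "\<mu> = - lam - of_int (int n - 2 * int (card A)) * y"
    have hB: "h_weight {b+2..n} B = 2 * int (card A) - int n - h_weight {a+2..n} A"
      unfolding B_def b_def by (rule h_weight_rev_set[OF a A False])
    have l: "of_int (h_weight {b+2..n} B) * y - \<mu> = lam - y * h"
      unfolding hB \<mu>_def h_def by (simp add: algebra_simps)
    have "lam - y * h \<noteq> 0" using gen(1)[of "- h_weight {a+2..n} A"] by (simp add: h_def algebra_simps)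
    moreover have "z' (b + 1) - z' b = z a - z (a + 1)" by (simp only: z'_def nb)
    ultimately have "W_fun n B \<mu> t z' y =
        R_diag (lam - y * h) (z a - z (a + 1)) y (a \<in> A) * W_fun n (s' ` B) \<mu> t (z' \<circ> s') y +
        R_off (lam - y * h) (z a - z (a + 1)) y (a \<in> A) * W_fun n B \<mu> t (z' \<circ> s') y"
      using W_fun_exchange_one[OF b _ fB, of y \<mu> z' t, folded s'_def, unfolded l mem] False gen(2) by auto
    then show ?thesis
      using False unfolding alt zs cs revs \<mu>_def[symmetric] z'_def[symmetric] B_def[symmetric]
      by (simp add: algebra_simps)
  qed
qed

lemma xi_fun_exchange:
  fixes lam y :: "'a::field" and z :: "nat \<Rightarrow> 'a" and a n :: nat
  defines "s \<equiv> transpose a (a + 1)"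
  assumes two: "(2::'a) \<noteq> 0" and a: "1 \<le> a" "a + 1 \<le> n"
    and I: "I \<subseteq> {1..n}" "a \<notin> I \<or> a + 1 \<notin> I"
    and gen: "\<And>l::int. lam + of_int l * y \<noteq> 0" "z a - z (a + 1) - y \<noteq> 0"
  shows "xi_fun n I lam z y =
    R_op n a (a + 1) {a+2..n} lam (z a - z (a + 1)) y (\<lambda>A. xi_fun n (s ` I) lam (z \<circ> s) y (s ` A))"
proof
  fix A
  define k where "k = card I"
  have s: "s permutes {1..n}" unfolding s_def using a by (intro permutes_swap_id) auto
  have inj: "inj s" by (simp add: s_def)
  have ss': "s (s i) = i" for i by (simp add: s_def)
  have card_s: "card (s ` B) = card B" for B by (intro card_image inj_on_subset[OF inj]) simp
  have sub_s: "s ` B \<subseteq> {1..n} \<longleftrightarrow> B \<subseteq> {1..n}" for B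
    using permutes_in_image[OF s] by blast
  have ks: "s ` B \<in> ksubsets n j \<longleftrightarrow> B \<in> ksubsets n j" for B j
    by (simp only: ksubsets_def mem_Collect_eq card_s sub_s)
  have sw: "swap_mem a (a + 1) A = s ` A" if "(a \<in> A) \<noteq> (a + 1 \<in> A)"
    using that by (auto simp: swap_mem_def s_def in_transpose_image_iff Transposition.transpose_def)
  have ss: "s ` s ` A = A" by (simp add: s_def image_image)
  have same: "s ` A = A" if "(a \<in> A) = (a + 1 \<in> A)"
    unfolding s_def using that by (rule transpose_image_eq)
  have fI: "finite I" using I(1) by (rule finite_subset) simp
  show "xi_fun n I lam z y A =
    R_op n a (a + 1) {a+2..n} lam (z a - z (a + 1)) y (\<lambda>A. xi_fun n (s ` I) lam (z \<circ> s) y (s ` A)) A"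
  proof (cases "A \<in> ksubsets n k")
    case False
    then have "xi_fun n (s ` I) lam (z \<circ> s) y (s ` A) = 0" "xi_fun n I lam z y A = 0"
      "xi_fun n (s ` I) lam (z \<circ> s) y A = 0"
      by (simp_all add: xi_fun_def ks card_s k_def)
    then show ?thesis using a by (subst R_op_alt) (auto simp: sw[simplified] ss)
  next
    case True
    then have A: "A \<subseteq> {1..n}" "card A = k" by (auto simp: ksubsets_def)
    have sA: "s ` A \<subseteq> {1..n}" "card (s ` A) = k" using A sub_s card_s by auto
    define t where "t = (\<lambda>r. z (nth_elem I r))"
    define q where "q = 1 / Q_fun n I z y"
    have Q: "Q_fun n (s ` I) (z \<circ> s) y = Q_fun n I z y"
    proof -
      have "s ` ({1..n} - I) = {1..n} - s ` I"
        unfolding image_set_diff[OF inj] permutes_image[OF s] by (rule refl)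
      then have "(\<Prod>b\<in>{1..n} - s ` I. f b) = (\<Prod>b\<in>{1..n} - I. f (s b))" for f :: "nat \<Rightarrow> 'a"
        using prod.reindex[OF inj_on_subset[OF inj subset_UNIV], of f "{1..n} - I"] by (simp only: comp_def)
      then show ?thesis
        unfolding Q_fun_def by (simp add: prod.reindex[OF inj_on_subset[OF inj subset_UNIV]] ss')
    qed
    have t: "(z \<circ> s) (nth_elem (s ` I) r) = t r" if "r \<in> {1..k}" for r
    proof -
      have "nth_elem (s ` I) r = s (nth_elem I r)"
        unfolding s_def by (rule nth_elem_image[OF fI strict_mono_on_transpose]) (use I that in \<open>auto simp: k_def\<close>)
      then show ?thesis by (simp add: t_def s_def)
    qed
    have W: "W_minus n B lam (\<lambda>r. (z \<circ> s) (nth_elem (s ` I) r)) (z \<circ> s) y = W_minus n B lam t (z \<circ> s) y"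
      if "B \<subseteq> {1..n}" "card B = k" for B
      using that t by (intro W_minus_cong) auto
    have xi': "xi_fun n (s ` I) lam (z \<circ> s) y B = q * W_minus n B lam t (z \<circ> s) y"
      if "B \<subseteq> {1..n}" "card B = k" for B
      using that W[OF that] by (simp add: xi_fun_def card_s Q q_def k_def[symmetric] ksubsets_def)
    have "xi_fun n I lam z y A = q * W_minus n A lam t z y"
      using True by (simp add: xi_fun_def q_def t_def k_def)
    also have "W_minus n A lam t z y =
      (if (a \<in> A) = (a + 1 \<in> A) then W_minus n A lam t (z \<circ> s) y
       else R_diag (lam - y * of_int (h_weight {a+2..n} A)) (z a - z (a + 1)) y (a \<in> A) * W_minus n (s ` A) lam t (z \<circ> s) y +
          R_off (lam - y * of_int (h_weight {a+2..n} A)) (z a - z (a + 1)) y (a \<in> A) * W_minus n A lam t (z \<circ> s) y)"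
      unfolding s_def by (rule W_minus_exchange[OF two a A(1) gen])
    finally have "xi_fun n I lam z y A =
      (if (a \<in> A) = (a + 1 \<in> A) then xi_fun n (s ` I) lam (z \<circ> s) y A
       else R_diag (lam - y * of_int (h_weight {a+2..n} A)) (z a - z (a + 1)) y (a \<in> A) * xi_fun n (s ` I) lam (z \<circ> s) y (s ` A) +
          R_off (lam - y * of_int (h_weight {a+2..n} A)) (z a - z (a + 1)) y (a \<in> A) * xi_fun n (s ` I) lam (z \<circ> s) y A)"
      by (simp only: xi'[OF A] xi'[OF sA] distrib_left mult.left_commute split: if_split) simp
    moreover have "A \<subseteq> {0..n}" using A(1) by auto
    ultimately show ?thesis using a by (subst R_op_alt) (auto simp: sw[simplified] ss same[simplified])
  qed
qed

section \<open>The eigenvector identity over a field\<close>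

definition row_free :: "nat \<Rightarrow> (nat \<Rightarrow> 'a::field) \<Rightarrow> 'a \<Rightarrow> 'a \<Rightarrow> nat \<Rightarrow> 'a" where
  "row_free n z y u i = (\<Prod>a\<in>{1..n} - {i}. if a < i then u - z a + y else u - z a)"

lemma weight_row_free:
  assumes "i \<in> {1..n}"
  shows "weight_row n J \<mu> z y u i = (\<mu> + u - z i - of_int (w_exp n i J) * y) * row_free n z y u i"
proof -
  have "weight_row n J \<mu> z y u i = (\<mu> + u - z i - of_int (w_exp n i J) * y) *
      (\<Prod>a\<in>{1..n} - {i}. if a < i then u - z a + y
        else if a = i then \<mu> + u - z a - of_int (w_exp n a J) * y else u - z a)"
    unfolding weight_row_def using assms by (subst prod.remove[of _ i]) auto
  also have "(\<Prod>a\<in>{1..n} - {i}. if a < i then u - z a + y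
        else if a = i then \<mu> + u - z a - of_int (w_exp n a J) * y else u - z a) = row_free n z y u i"
    unfolding row_free_def by (rule prod.cong) auto
  finally show ?thesis .
qed

lemma row_free_eq_0:
  assumes "a \<in> {1..n}" "i < a" "u = z a"
  shows "row_free n z y u i = 0"
  unfolding row_free_def using assms by (intro prod_zero bexI[of _ a]) auto

text \<open>Under every permutation the row of \<open>i\<close> receives some \<open>z_a\<close>
  with \<open>a > n - card J\<close>, hence \<open>a > i\<close>, and so contains the factor
  \<open>z_a - z_a\<close>.\<close>

lemma W_fun_eq_0:
  fixes z :: "nat \<Rightarrow> 'a::field"
  assumes J: "J \<subseteq> {1..n}" "i \<in> J" "i + card J \<le> n"
  shows "W_fun n J \<mu> (\<lambda>r. z (n + 1 - r)) z y = 0"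
proof -
  have fJ: "finite J" using J(1) by (rule finite_subset) simp
  obtain r where r: "r \<in> {1..card J}" "nth_elem J r = i" using nth_elem_surj[OF fJ J(2)] .
  have "weight_term n J \<mu> ((\<lambda>r. z (n + 1 - r)) \<circ> \<pi>) z y = 0" if "\<pi> permutes {1..card J}" for \<pi>
  proof -
    have \<pi>: "\<pi> r \<in> {1..card J}" using permutes_in_image[OF that] r(1) by blast
    have "row_free n z y (z (n + 1 - \<pi> r)) i = 0"
      by (rule row_free_eq_0[of "n + 1 - \<pi> r"]) (use \<pi> J(3) in auto)
    then have "weight_row n J \<mu> z y (((\<lambda>r. z (n + 1 - r)) \<circ> \<pi>) r) (nth_elem J r) = 0"
      using J r by (subst weight_row_free) auto
    then show ?thesis unfolding weight_term_def using r(1) by (auto intro!: prod_zero)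
  qed
  then show ?thesis by (simp add: W_fun_alt)
qed

lemma nth_elem_interval:
  assumes "1 \<le> r" "m + r \<le> n"
  shows "nth_elem {m+1..n} r = m + r"
proof -
  have "sorted_list_of_set {m+1..n} = [m+1..<n+1]"
    by (metis Suc_eq_plus1 atLeastLessThanSuc_atLeastAtMost sorted_list_of_set_range)
  then show ?thesis using assms by (simp add: nth_elem_def del: upt_Suc)
qed

text \<open>\<open>\<pi>\<close> dominates the reversal pointwise and has the same sum of values, so
  no inequality can be strict.\<close>

lemma permutes_ge_rev:
  assumes "\<pi> permutes {1..k::nat}" "\<And>r. r \<in> {1..k} \<Longrightarrow> k + 1 \<le> \<pi> r + r" "r \<in> {1..k}"
  shows "\<pi> r = k + 1 - r"
proof -
  have "(\<Sum>r\<in>{1..k}. \<pi> r) = (\<Sum>r\<in>{1..k}. r)"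
    using sum.permute[OF assms(1), of "\<lambda>r. r"] by (simp add: comp_def)
  also have "\<dots> = (\<Sum>r\<in>{1..k}. k + 1 - r)"
    by (rule sum.reindex_bij_witness[where i = "\<lambda>r. k + 1 - r" and j = "\<lambda>r. k + 1 - r"]) auto
  finally have eq: "(\<Sum>r\<in>{1..k}. \<pi> r) = (\<Sum>r\<in>{1..k}. k + 1 - r)" .
  show ?thesis
  proof (rule ccontr)
    assume "\<pi> r \<noteq> k + 1 - r"
    then have "k + 1 - r < \<pi> r" using assms(2)[OF assms(3)] by simp
    moreover have "k + 1 - r' \<le> \<pi> r'" if "r' \<in> {1..k}" for r' using assms(2)[OF that] by simp
    ultimately have "(\<Sum>r\<in>{1..k}. k + 1 - r) < (\<Sum>r\<in>{1..k}. \<pi> r)"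
      using assms(3) by (intro sum_strict_mono_ex1) auto
    then show False using eq by simp
  qed
qed

text \<open>The summand of \<open>\<pi>\<close> vanishes unless
  \<open>n + 1 - \<pi> r \<le> n - k + r\<close> for all \<open>r\<close>, which leaves only the
  reversal. Then \<open>t\<close> and \<open>z\<close> cancel in every diagonal factor, leaving
  \<open>\<mu> - (k - r) y\<close>. The constant \<open>K\<close> is chosen before
  \<open>\<mu>\<close> because the values at \<open>\<lambda>\<close> and
  \<open>\<lambda> + y\<close> are to be compared; its form is irrelevant.\<close>

lemma W_fun_top:
  fixes z :: "nat \<Rightarrow> 'a::field"
  assumes k: "k \<le> n"
  shows "\<exists>K. \<forall>\<mu>. W_fun n {n-k+1..n} \<mu> (\<lambda>r. z (n + 1 - r)) z y = (\<Prod>m<k. \<mu> - of_nat m * y) * K"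
proof -
  define J where "J = {n-k+1..n}"
  define t where "t = (\<lambda>r. z (n + 1 - r))"
  define N where "N = (\<lambda>\<pi>. (\<Prod>r\<in>{1..k}. row_free n z y (t (\<pi> r)) (n - k + r)) * pair_factor k y (t \<circ> \<pi>))"
  have card: "card J = k" using k by (simp add: J_def)
  have nth: "nth_elem J r = n - k + r" if "r \<in> {1..k}" for r
    unfolding J_def using that k by (intro nth_elem_interval) auto
  have main: "weight_term n J \<mu> (t \<circ> \<pi>) z y = (\<Prod>m<k. \<mu> - of_nat m * y) * N \<pi>"
    if \<pi>: "\<pi> permutes {1..k}" for \<mu> \<pi>
  proof -
    have wt: "weight_term n J \<mu> (t \<circ> \<pi>) z y =
      (\<Prod>r\<in>{1..k}. (\<mu> + t (\<pi> r) - z (n - k + r) - of_int (w_exp n (n - k + r) J) * y) *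
        row_free n z y (t (\<pi> r)) (n - k + r)) * pair_factor k y (t \<circ> \<pi>)"
      unfolding weight_term_def card using k
      by (intro arg_cong2[where f = "(*)"] prod.cong refl)
        (simp only: nth comp_apply, rule weight_row_free, auto)
    show ?thesis
    proof (cases "\<forall>r\<in>{1..k}. k + 1 \<le> \<pi> r + r")
      case False
      then obtain r where r: "r \<in> {1..k}" "\<pi> r + r \<le> k" by (auto simp: not_le)
      have "\<pi> r \<in> {1..k}" using permutes_in_image[OF \<pi>] r(1) by blast
      then have "row_free n z y (t (\<pi> r)) (n - k + r) = 0"
        by (intro row_free_eq_0[of "n + 1 - \<pi> r"]) (use r k in \<open>auto simp: t_def\<close>)
      then have "N \<pi> = 0" "weight_term n J \<mu> (t \<circ> \<pi>) z y = 0"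
        unfolding N_def wt using r(1) by (auto intro!: prod_zero)
      then show ?thesis by simp
    next
      case True
      have eq: "\<mu> + t (\<pi> r) - z (n - k + r) - of_int (w_exp n (n - k + r) J) * y = \<mu> - of_nat (k - r) * y"
        if "r \<in> {1..k}" for r
      proof -
        have "\<pi> r = k + 1 - r" using permutes_ge_rev[OF \<pi> _ that] True by blast
        then have "n + 1 - \<pi> r = n - k + r" using that k by auto
        moreover have "w_exp n (n - k + r) J = int (k - r)"
        proof -
          have "h_weight {n - k + r + 1..n} J = (\<Sum>j\<in>{n - k + r + 1..n}. 1)"
            unfolding h_weight_def J_def by (intro sum.cong) auto
          then show ?thesis unfolding w_exp_eq_h_weight using that k by simp
        qed
        ultimately show ?thesis by (simp add: t_def)
      qed
      have "(\<Prod>r\<in>{1..k}. \<mu> - of_nat (k - r) * y) = (\<Prod>m<k. \<mu> - of_nat m * y)"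
        by (rule prod.reindex_bij_witness[where i = "\<lambda>m. k - m" and j = "\<lambda>r. k - r"]) auto
      then show ?thesis
        unfolding wt prod.distrib N_def by (simp add: eq)
    qed
  qed
  then have "\<forall>\<mu>. W_fun n J \<mu> t z y = (\<Prod>m<k. \<mu> - of_nat m * y) * (y ^ k * (\<Sum>\<pi> | \<pi> permutes {1..k}. N \<pi>))"
    unfolding W_fun_alt card by (simp add: sum_distrib_left algebra_simps)
  then show ?thesis unfolding J_def t_def by blast
qed

text \<open>Reversal moves \<open>{1..k}\<close> to the top \<open>k\<close> sites, and in terms of
  \<open>z'\<close> the substitution \<open>t_r = z_r\<close> has the shape of the two preceding
  vanishing and evaluation lemmas. The second equation, written without division, says that the
  shift multiplies the coordinate by the inverse of the prefactor in
  \<open>prod_R_diag_telescope\<close>.\<close>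

lemma xi_fun_initial:
  fixes lam y :: "'a::field" and z :: "nat \<Rightarrow> 'a"
  assumes k: "k \<le> n"
  shows "A \<noteq> {1..k} \<Longrightarrow> xi_fun n {1..k} lam z y A = 0"
    and "xi_fun n {1..k} (lam + y) z y {1..k} * (lam + (of_nat n - 2 * of_nat k) * y) =
      xi_fun n {1..k} lam z y {1..k} * (lam + (of_nat n - of_nat k) * y)"
proof -
  define z' where "z' = (\<lambda>i. z (n + 1 - i))"
  have t: "z (nth_elem {1..k} r) = z' (n + 1 - r)" if "r \<in> {1..k}" for r
    using that k nth_elem_interval[of r 0 k] by (simp add: z'_def)
  have W: "W_minus n A lam (\<lambda>r. z (nth_elem {1..k} r)) z y = W_minus n A lam (\<lambda>r. z' (n + 1 - r)) z y"
    if "A \<in> ksubsets n k" for A lam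
    by (rule W_minus_cong) (use that t in \<open>auto simp: ksubsets_def\<close>)
  show "xi_fun n {1..k} lam z y A = 0" if A: "A \<noteq> {1..k}"
  proof (cases "A \<in> ksubsets n k")
    case True
    then have A': "A \<subseteq> {1..n}" "card A = k" by (auto simp: ksubsets_def)
    have "\<not> A \<subseteq> {1..k}" using A A'(2) card_subset_eq[of "{1..k}" A] by auto
    \<comment> \<open>The mirror image \<open>n + 1 - j\<close> is at most \<open>n - k\<close>, the
      range where \<open>W_fun_eq_0\<close> applies.\<close>
    then obtain j where j: "j \<in> A" "j > k" "j \<le> n" using A'(1) by (auto simp: subset_iff)
    have "W_fun n (rev_set n A) \<mu> (\<lambda>r. z' (n + 1 - r)) z' y = 0" for \<mu>
    proof (rule W_fun_eq_0)
      show "rev_set n A \<subseteq> {1..n}" by (auto simp: rev_set_def)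
      show "n + 1 - j \<in> rev_set n A" using j by (auto simp: rev_set_def)
      show "n + 1 - j + card (rev_set n A) \<le> n" using j A'(2) card_rev_set[OF A'(1)] by simp
    qed
    then have "W_minus n A lam (\<lambda>r. z' (n + 1 - r)) z y = 0"
      unfolding W_minus_alt z'_def[symmetric] by simp
    then show ?thesis unfolding xi_fun_def card_atLeastAtMost diff_Suc_1 W[OF True] by simp
  qed (simp add: xi_fun_def)
  have K: "{1..k} \<in> ksubsets n k" using k by (auto simp: ksubsets_def)
  have rev: "rev_set n {1..k} = {n-k+1..n}" using k by (auto simp: rev_set_def)
  obtain K where W_top: "\<And>\<mu>. W_fun n {n-k+1..n} \<mu> (\<lambda>r. z' (n + 1 - r)) z' y = (\<Prod>m<k. \<mu> - of_nat m * y) * K"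
    using W_fun_top[OF k] by blast
  define c where "c = 1 / Q_fun n {1..k} z y * ((- 1) ^ k / e_fun k (\<lambda>r. z' (n + 1 - r)) y)"
  define P where "P = (\<lambda>\<mu>. \<Prod>m<k. \<mu> - of_nat m * y)"
  have xi: "xi_fun n {1..k} l z y {1..k} = c * (P (- l - (of_nat n - 2 * of_nat k) * y) * K)" for l
  proof -
    have "xi_fun n {1..k} l z y {1..k} = 1 / Q_fun n {1..k} z y * W_minus n {1..k} l (\<lambda>r. z' (n + 1 - r)) z y"
      using K unfolding xi_fun_def card_atLeastAtMost diff_Suc_1 W[OF K] by simp
    then show ?thesis
      unfolding W_minus_alt z'_def[symmetric] rev W_top by (simp add: c_def P_def)
  qed
  \<comment> \<open>Both sides are the product over \<open>m \<le> k\<close>, split off at its first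
    or at its last factor.\<close>
  have P: "P (\<mu> - y) * \<mu> = P \<mu> * (\<mu> - of_nat k * y)" for \<mu>
  proof -
    have "(\<Prod>m<Suc k. \<mu> - of_nat m * y) = \<mu> * (\<Prod>m<k. \<mu> - of_nat (Suc m) * y)"
      unfolding prod.lessThan_Suc_shift by simp
    moreover have "(\<Prod>m<Suc k. \<mu> - of_nat m * y) = P \<mu> * (\<mu> - of_nat k * y)"
      by (simp add: P_def)
    moreover have "(\<Prod>m<k. \<mu> - of_nat (Suc m) * y) = P (\<mu> - y)"
      unfolding P_def by (rule prod.cong) (simp_all add: algebra_simps)
    ultimately show ?thesis by (simp only: mult.commute)
  qed
  show "xi_fun n {1..k} (lam + y) z y {1..k} * (lam + (of_nat n - 2 * of_nat k) * y) =
      xi_fun n {1..k} lam z y {1..k} * (lam + (of_nat n - of_nat k) * y)"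
  proof -
    define \<mu> where "\<mu> = - lam - (of_nat n - 2 * of_nat k) * y"
    have e: "- (lam + y) - (of_nat n - 2 * of_nat k) * y = \<mu> - y"
      "lam + (of_nat n - 2 * of_nat k) * y = - \<mu>"
      "lam + (of_nat n - of_nat k) * y = - (\<mu> - of_nat k * y)"
      by (simp_all add: \<mu>_def algebra_simps)
    show ?thesis unfolding xi \<mu>_def[symmetric] e using P[of \<mu>]
      by (metis (no_types, opaque_lifting) mult.assoc mult.commute mult_minus_right)
  qed
qed

text \<open>Without such an \<open>a\<close> the set would be closed under predecessors down to 1,
  hence an initial segment.\<close>

lemma exists_descent:
  assumes "I \<subseteq> {1..n}" "I \<noteq> {1..card I}"
  obtains a where "1 \<le> a" "a + 1 \<le> n" "a \<notin> I" "a + 1 \<in> I"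
proof (rule ccontr)
  assume "\<not> thesis"
  with that assms(1) have down: "a \<in> I" if "a + 1 \<in> I" "1 \<le> a" for a using that by fastforce
  have fin: "finite I" using assms(1) by (rule finite_subset) simp
  show False
  proof (cases "I = {}")
    case False
    have *: "Max I - j \<in> I" if "j < Max I" for j
      using that
    proof (induction j)
      case 0 show ?case using Max_in[OF fin False] by simp
    next
      case (Suc j)
      then have "Max I - j = Max I - Suc j + 1" by simp
      then show ?case using Suc down[of "Max I - Suc j"] by simp
    qed
    have "I = {1..Max I}"
    proof (intro equalityI subsetI)
      fix x assume "x \<in> {1..Max I}"
      then show "x \<in> I" using *[of "Max I - x"] by auto
    qed (use assms(1) fin in auto)
    then show False using assms(2) by (metis card_atLeastAtMost diff_Suc_1 One_nat_def Suc_eq_plus1 add_diff_cancel_right')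
  qed (use assms(2) in auto)
qed

lemma R_op_scale: "R_op n p q S lam x y (\<lambda>B. c * \<zeta> B) A = c * R_op n p q S lam x y \<zeta> A"
  by (simp add: R_op_def sum_distrib_left mult.left_commute)

text \<open>The measure is the sum of the elements of \<open>I\<close>: the transposition moves
  \<open>a + 1\<close> down to \<open>a\<close> and lowers it by one. \<open>z\<close> is arbitrary
  because the step passes to \<open>z \<circ> s\<close>; the genericity hypotheses are invariant
  under permuting the \<open>z_i\<close>, and so is the eigenvalue when \<open>I\<close> moves
  along.\<close>

lemma xi_fun_eigenvector:
  fixes lam w y :: "'a::field" and z :: "nat \<Rightarrow> 'a"
  assumes two: "(2::'a) \<noteq> 0" and gen: "\<And>l::int. lam + of_int l * y \<noteq> 0"
    and "\<And>i. i \<in> {1..n} \<Longrightarrow> w - z i - y \<noteq> 0"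
    and "\<And>i j. i \<in> {1..n} \<Longrightarrow> j \<in> {1..n} \<Longrightarrow> i \<noteq> j \<Longrightarrow> z i - z j - y \<noteq> 0"
    and "I \<subseteq> {1..n}"
  shows "L_entry n 2 2 lam w z y (xi_fun n I (lam + y) z y) =
    (\<lambda>A. (\<Prod>i\<in>I. (w - z i) / (w - z i - y)) * xi_fun n I lam z y A)"
  using assms(3-5)
proof (induction "\<Sum>I" arbitrary: I z rule: less_induct)
  case less
  note wz = less.prems(1) and zz = less.prems(2) and I = less.prems(3)
  define k where "k = card I"
  show ?case
  proof (cases "I = {1..k}")
    case True
    have "k \<le> n" unfolding k_def using card_mono[OF _ I] by simp
    note k = this
    have xi0: "xi_fun n I l z y = (\<lambda>A. if A = {1..k} then xi_fun n I l z y {1..k} else 0)" for l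
    proof
      fix A
      show "xi_fun n I l z y A = (if A = {1..k} then xi_fun n I l z y {1..k} else 0)"
        using xi_fun_initial(1)[OF k, of A l z y] True by (cases "A = {1..k}") simp_all
    qed
    have gen1: "lam + (of_nat n - of_nat k) * y \<noteq> 0" using gen[of "int n - int k"] by simp
    show ?thesis
    proof
      fix A
      show "L_entry n 2 2 lam w z y (xi_fun n I (lam + y) z y) A =
          (\<Prod>i\<in>I. (w - z i) / (w - z i - y)) * xi_fun n I lam z y A"
      proof (cases "A \<subseteq> {1..n}")
        case False
        then have "A \<notin> ksubsets n k" by (auto simp: ksubsets_def)
        then show ?thesis using False by (simp add: L_entry_def xi_fun_def k_def)
      next
        case A: True
        define X where "X = xi_fun n I (lam + y) z y {1..k}"
        have xiX: "xi_fun n I (lam + y) z y = (\<lambda>A. if A = {1..k} then X else 0)"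
          unfolding X_def by (rule xi0)
        define c where "c = (\<Prod>i\<in>I. (w - z i) / (w - z i - y))"
        define r where "r = (lam + (of_nat n - 2 * of_nat k) * y) / (lam + (of_nat n - of_nat k) * y)"
        have "L_entry n 2 2 lam w z y (xi_fun n I (lam + y) z y) A = (if A = {1..k} then r * c * X else 0)"
          unfolding xiX L22_highest_coordinate[OF k A] prod_R_diag_telescope[OF k gen] r_def c_def
          by (simp only: True[symmetric])
        moreover have "r * X = xi_fun n I lam z y {1..k}"
          using xi_fun_initial(2)[OF k, of lam y z] gen1 unfolding X_def True[symmetric] r_def
          by (simp add: field_simps)
        moreover have "xi_fun n I lam z y A = (if A = {1..k} then xi_fun n I lam z y {1..k} else 0)"
          by (rule fun_cong[OF xi0])
        ultimately show ?thesis unfolding c_def[symmetric] by (auto simp: mult_ac)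
      qed
    qed
  next
    case False
    then obtain a where a: "1 \<le> a" "a + 1 \<le> n" "a \<notin> I" "a + 1 \<in> I"
      using exists_descent[OF I] unfolding k_def by blast
    define s where "s = transpose a (a + 1)"
    have s: "s permutes {1..n}" unfolding s_def using a by (intro permutes_swap_id) auto
    have inj: "inj s" by (simp add: s_def)
    have fI: "finite I" using I by (rule finite_subset) simp
    have sI: "s ` I = insert a (I - {a + 1})"
      using a unfolding s_def by (auto simp: in_transpose_image_iff Transposition.transpose_def split: if_splits)
    have "\<Sum>(s ` I) < \<Sum>I"
    proof -
      have "\<Sum>(s ` I) = a + \<Sum>(I - {a + 1})" unfolding sI using fI a by (subst sum.insert) auto
      moreover have "\<Sum>I = (a + 1) + \<Sum>(I - {a + 1})" using fI a by (subst sum.remove[of _ "a + 1"]) auto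
      ultimately show ?thesis by simp
    qed
    moreover have sin: "s i \<in> {1..n} \<longleftrightarrow> i \<in> {1..n}" for i using permutes_in_image[OF s] .
    have "w - (z \<circ> s) i - y \<noteq> 0" if "i \<in> {1..n}" for i
      using wz[of "s i"] that sin[of i] by simp
    moreover have "(z \<circ> s) i - (z \<circ> s) j - y \<noteq> 0" if "i \<in> {1..n}" "j \<in> {1..n}" "i \<noteq> j" for i j
      using zz[of "s i" "s j"] that sin[of i] sin[of j] inj by (auto simp: inj_eq)
    moreover have "s ` I \<subseteq> {1..n}" using I sin by blast
    ultimately have IH: "L_entry n 2 2 lam w (z \<circ> s) y (xi_fun n (s ` I) (lam + y) (z \<circ> s) y) =
      (\<lambda>A. (\<Prod>i\<in>s ` I. (w - (z \<circ> s) i) / (w - (z \<circ> s) i - y)) * xi_fun n (s ` I) lam (z \<circ> s) y A)"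
      by (rule less.hyps)
    have ss: "s (s i) = i" for i by (simp add: s_def)
    have prod_s: "(\<Prod>i\<in>s ` I. (w - (z \<circ> s) i) / (w - (z \<circ> s) i - y)) = (\<Prod>i\<in>I. (w - z i) / (w - z i - y))"
      by (subst prod.reindex[OF inj_on_subset[OF inj subset_UNIV]]) (simp add: ss)
    have gen': "lam + y + of_int l * y \<noteq> 0" for l :: int
      using gen[of "l + 1"] by (simp add: algebra_simps)
    have za: "z a - z (a + 1) - y \<noteq> 0" using zz[of a "a + 1"] a by simp
    have aI: "a \<notin> I \<or> a + 1 \<notin> I" using a by simp
    define c where "c = (\<Prod>i\<in>I. (w - z i) / (w - z i - y))"
    note ex = xi_fun_exchange[OF two a(1,2) I aI _ za, folded s_def]
    show ?thesis
    proof
      fix A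
      show "L_entry n 2 2 lam w z y (xi_fun n I (lam + y) z y) A =
          (\<Prod>i\<in>I. (w - z i) / (w - z i - y)) * xi_fun n I lam z y A"
      proof (cases "A \<subseteq> {1..n}")
        case False
        then have "A \<notin> ksubsets n k" by (auto simp: ksubsets_def)
        then show ?thesis using False by (simp add: L_entry_def xi_fun_def k_def)
      next
        case A: True
        \<comment> \<open>The exchange relation for the vector is used twice, at
          \<open>lam + y\<close> for the argument of \<open>L_22\<close> and at \<open>lam\<close>
          for the result; these are the two parameters of the R-matrices in
          \<open>L_entry_exchange\<close>.\<close>
        have "L_entry n 2 2 lam w z y (xi_fun n I (lam + y) z y) A =
          R_op n a (a + 1) {a+2..n} lam (z a - z (a + 1)) y
            (\<lambda>B. L_entry n 2 2 lam w (z \<circ> s) y (xi_fun n (s ` I) (lam + y) (z \<circ> s) y) (s ` B)) A"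
          unfolding ex[OF gen'] unfolding s_def
          by (rule L_entry_exchange[OF a(1,2) gen wz za A])
        also have "\<dots> = c * R_op n a (a + 1) {a+2..n} lam (z a - z (a + 1)) y
            (\<lambda>B. xi_fun n (s ` I) lam (z \<circ> s) y (s ` B)) A"
          unfolding IH prod_s c_def[symmetric] by (rule R_op_scale)
        also have "\<dots> = c * xi_fun n I lam z y A"
          unfolding ex[OF gen] ..
        finally show ?thesis unfolding c_def .
      qed
    qed
  qed
qed

section \<open>Specialization to the indeterminates\<close>

text \<open>A field homomorphism commutes with every rational expression, division by zero included
  since \<open>x / 0 = 0\<close> on both sides. So the shift of \<open>\<lambda>\<close> and the
  embedding into Laurent series pass through \<open>xi_fun\<close> to its arguments.\<close>

locale field_hom =
  fixes h :: "'a::field \<Rightarrow> 'b::field"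
  assumes hom_one: "h 1 = 1" and hom_add: "h (a + b) = h a + h b" and hom_mult: "h (a * b) = h a * h b"
begin

lemma hom_zero: "h 0 = 0"
  using hom_add[of 0 0] unfolding add_0_right by (metis add_cancel_left_right)

lemma hom_uminus: "h (- a) = - h a"
  using hom_add[of "- a" a] by (simp add: hom_zero eq_neg_iff_add_eq_0)

lemma hom_diff: "h (a - b) = h a - h b"
  using hom_add[of a "- b"] by (simp add: hom_uminus)

lemma hom_eq_0_iff: "h a = 0 \<longleftrightarrow> a = 0"
  using hom_mult[of a "inverse a"] by (cases "a = 0") (auto simp: hom_zero hom_one)

lemma hom_divide: "h (a / b) = h a / h b"
  using hom_mult[of "a / b" b] by (cases "b = 0") (simp_all add: hom_zero hom_eq_0_iff field_simps)

lemma hom_power: "h (a ^ m) = h a ^ m"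
  by (induction m) (simp_all add: hom_one hom_mult)

lemma hom_sum: "h (sum f A) = (\<Sum>x\<in>A. h (f x))"
  by (induction A rule: infinite_finite_induct) (simp_all add: hom_zero hom_add)

lemma hom_prod: "h (prod f A) = (\<Prod>x\<in>A. h (f x))"
  by (induction A rule: infinite_finite_induct) (simp_all add: hom_one hom_mult)

lemma hom_of_nat: "h (of_nat m) = of_nat m"
  by (induction m) (simp_all add: hom_zero hom_one hom_add)

lemma hom_of_int: "h (of_int m) = of_int m"
  by (cases m) (simp_all add: hom_of_nat hom_uminus hom_diff hom_one)

lemmas hom_simps = hom_zero hom_one hom_add hom_mult hom_uminus hom_diff hom_divide hom_power
  hom_sum hom_prod hom_of_int

lemma hom_l_factor: "h (l_factor n I lam t z y r a) = l_factor n I (h lam) (\<lambda>r. h (t r)) (\<lambda>a. h (z a)) (h y) r a"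
  by (simp add: l_factor_def hom_simps)

lemma hom_W_fun: "h (W_fun n I lam t z y) = W_fun n I (h lam) (\<lambda>r. h (t r)) (\<lambda>a. h (z a)) (h y)"
  by (simp add: W_fun_def Let_def hom_simps hom_l_factor)

lemma hom_xi_fun: "h (xi_fun n I lam z y A) = xi_fun n I (h lam) (\<lambda>a. h (z a)) (h y) A"
  by (simp add: xi_fun_def W_minus_def W_perm_fun_def Let_def e_fun_def Q_fun_def hom_simps hom_W_fun
      del: of_int_diff)

end

lemma field_hom_comp:
  assumes "field_hom f" "field_hom g"
  shows "field_hom (\<lambda>x. g (f x))"
  using assms by (simp add: field_hom_def)

lemma field_hom_fls_const: "field_hom (fls_const :: 'a::field \<Rightarrow> 'a fls)"
  by unfold_locales (simp_all add: fls_plus_const)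

lemma field_hom_shift_lam:
  fixes c :: "'a::field"
  shows "field_hom (shift_lam c)"
proof
  have deg: "degree [:c, 1:] > 0" by simp
  show "shift_lam c 1 = 1" by (simp add: One_fract_def shift_lam_Fract pcompose_1)
  fix a b :: "'a poly fract"
  obtain p q p' q' where ab: "a = Fraction_Field.Fract p q" "q \<noteq> 0" "b = Fraction_Field.Fract p' q'" "q' \<noteq> 0"
    by (metis Fract_cases)
  have nz: "pcompose q [:c, 1:] \<noteq> 0" "pcompose q' [:c, 1:] \<noteq> 0"
    using ab by (simp_all only: pcompose_eq_0_iff[OF deg]) simp_all
  show "shift_lam c (a + b) = shift_lam c a + shift_lam c b"
    using ab nz by (simp add: shift_lam_Fract pcompose_add pcompose_mult)
  show "shift_lam c (a * b) = shift_lam c a * shift_lam c b"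
    using ab nz by (simp add: shift_lam_Fract pcompose_mult)
qed

lemma field_hom_embed_zy: "field_hom embed_zy"
proof
  show "embed_zy 1 = 1" unfolding embed_zy_def by (simp flip: one_pCons One_fract_def)
qed (simp_all add: embed_zy_def mult.commute)

interpretation embed: field_hom embed_zy by (rule field_hom_embed_zy)

lemma shift_lam_var: "shift_lam c lam_var = lam_var + embed_zy c"
  by (simp add: lam_var_def embed_zy_def shift_lam_Fract pcompose_pCons pcompose_1)

lemma shift_lam_embed_zy: "shift_lam c (embed_zy d) = embed_zy d"
  by (simp add: embed_zy_def shift_lam_Fract pcompose_1)

lemma Fract_one_eq_0_iff: "Fraction_Field.Fract p 1 = 0 \<longleftrightarrow> p = (0 :: 'a::idom)"
  by (simp add: Zero_fract_def eq_fract)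

lemma two_fract_nonzero: "(2 :: 'a::idom) \<noteq> 0 \<Longrightarrow> (2 :: 'a fract) \<noteq> 0"
  unfolding one_add_one[symmetric] One_fract_def by (simp add: Fract_one_eq_0_iff)

lemma two_ratfun_nonzero: "(2 :: ratfun) \<noteq> 0"
proof -
  have "(2 :: zy_poly) \<noteq> 0" by simp
  then have "(2 :: zy_field) \<noteq> 0" by (rule two_fract_nonzero)
  then have "(2 :: zy_field poly) \<noteq> 0" by (simp add: numeral_poly)
  then show ?thesis by (rule two_fract_nonzero)
qed

lemma lam_var_add_embed_zy: "lam_var + embed_zy c \<noteq> 0"
  by (simp add: lam_var_def embed_zy_def Fract_one_eq_0_iff)

lemma zy_var_diff_nonzero:
  assumes "i \<noteq> j" "i \<noteq> 0"
  shows "zy_var i - zy_var j - zy_var 0 \<noteq> 0"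
proof -
  have inj: "Poly_Mapping.single a (1::nat) = Poly_Mapping.single b 1 \<longleftrightarrow> a = b" for a b :: nat
    by (metis lookup_single_eq lookup_single_not_eq zero_neq_one)
  define S where "S = (\<lambda>i. Poly_Mapping.single (Poly_Mapping.single i (1::nat)) 1 :: zy_poly)"
  have "Poly_Mapping.lookup (S i - S j - S 0) (Poly_Mapping.single i 1) = 1"
    using assms by (simp add: S_def lookup_minus lookup_single inj[simplified] when_def)
  then have "S i - S j - S 0 \<noteq> 0" by (metis lookup_zero zero_neq_one)
  then show ?thesis by (simp add: zy_var_def S_def Fract_one_eq_0_iff)
qed

lemma L22_tilde_xi:
  assumes "I \<subseteq> {1..n}"
  shows "L22_tilde n (xi n I) =
    (\<lambda>J. (\<Prod>i\<in>I. (w_ser - z_ser i) / (w_ser - z_ser i - y_ser)) * fls_const (xi n I J))"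
proof -
  interpret C: field_hom "fls_const :: ratfun \<Rightarrow> ratfun fls" by (rule field_hom_fls_const)
  have shift: "field_hom (\<lambda>x. fls_const (shift_lam (zy_var 0) x))"
    by (rule field_hom_comp[OF field_hom_shift_lam field_hom_fls_const])
  have xi_shift: "(\<lambda>A. fls_const (shift_lam (zy_var 0) (xi n I A))) = xi_fun n I (lam_ser + y_ser) z_ser y_ser"
    unfolding xi_def field_hom.hom_xi_fun[OF shift]
    by (simp add: shift_lam_var z_var_def[abs_def] y_var_def shift_lam_embed_zy C.hom_add
        lam_ser_def z_ser_def[abs_def] y_ser_def)
  have xi: "fls_const (xi n I J) = xi_fun n I lam_ser z_ser y_ser J" for J
    unfolding xi_def C.hom_xi_fun by (simp add: lam_ser_def z_ser_def[abs_def] y_ser_def)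
  show ?thesis
    unfolding L22_tilde_def xi_shift xi
  proof (rule xi_fun_eigenvector)
    show "(2 :: ratfun fls) \<noteq> 0" using fls_const_nonzero[OF two_ratfun_nonzero] by simp
    show "lam_ser + of_int l * y_ser \<noteq> 0" for l
    proof -
      have "lam_ser + of_int l * y_ser = fls_const (lam_var + embed_zy (of_int l * zy_var 0))"
        by (simp add: lam_ser_def y_ser_def y_var_def embed.hom_simps C.hom_simps)
      then show ?thesis using lam_var_add_embed_zy by simp
    qed
    show "w_ser - z_ser i - y_ser \<noteq> 0" for i
    proof -
      \<comment> \<open>The series variable is the inverse of \<open>w\<close>, so index
        \<open>-1\<close> is the coefficient of \<open>w\<close>.\<close>
      have "fls_nth (w_ser - z_ser i - y_ser) (- 1) = 1" by (simp add: w_ser_def z_ser_def y_ser_def)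
      then show ?thesis by (metis fls_zero_nth zero_neq_one)
    qed
    show "z_ser i - z_ser j - y_ser \<noteq> 0" if "i \<in> {1..n}" "j \<in> {1..n}" "i \<noteq> j" for i j
    proof -
      have "z_ser i - z_ser j - y_ser = fls_const (embed_zy (zy_var i - zy_var j - zy_var 0))"
        by (simp add: z_ser_def z_var_def y_ser_def y_var_def embed.hom_simps C.hom_simps)
      then show ?thesis using zy_var_diff_nonzero[of i j] that by (simp add: embed.hom_eq_0_iff)
    qed
  qed (rule assms)
qed

section \<open>Membership of the coordinates in the coefficient ring\<close>

locale subring_set =
  fixes T :: "'a::comm_ring_1 set"
  assumes one_in: "1 \<in> T" and add_in: "a \<in> T \<Longrightarrow> b \<in> T \<Longrightarrow> a + b \<in> T"
    and mult_in: "a \<in> T \<Longrightarrow> b \<in> T \<Longrightarrow> a * b \<in> T" and uminus_in: "a \<in> T \<Longrightarrow> - a \<in> T"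
begin

lemma zero_in: "0 \<in> T"
  using add_in[OF one_in uminus_in[OF one_in]] by simp

lemma diff_in: "a \<in> T \<Longrightarrow> b \<in> T \<Longrightarrow> a - b \<in> T"
  using add_in[of a "- b"] uminus_in[of b] by simp

lemma sum_in: "(\<And>x. x \<in> A \<Longrightarrow> f x \<in> T) \<Longrightarrow> sum f A \<in> T"
  by (induction A rule: infinite_finite_induct) (auto simp: zero_in add_in)

lemma prod_in: "(\<And>x. x \<in> A \<Longrightarrow> f x \<in> T) \<Longrightarrow> prod f A \<in> T"
  by (induction A rule: infinite_finite_induct) (auto simp: one_in mult_in)

lemma power_in: "a \<in> T \<Longrightarrow> a ^ m \<in> T"
  by (induction m) (auto simp: one_in mult_in)

lemma of_nat_in: "of_nat m \<in> T"
  by (induction m) (auto simp: zero_in one_in add_in)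

lemma of_int_in: "of_int m \<in> T"
  by (cases m) (simp_all add: of_nat_in one_in uminus_in diff_in)

lemmas closed = zero_in one_in add_in mult_in uminus_in diff_in sum_in prod_in power_in of_int_in

end

locale subfield_set = subring_set T for T :: "'a::field set" +
  assumes inverse_in: "a \<in> T \<Longrightarrow> inverse a \<in> T"
begin

lemma divide_in: "a \<in> T \<Longrightarrow> b \<in> T \<Longrightarrow> a / b \<in> T"
  by (simp add: divide_inverse mult_in inverse_in)

end

text \<open>Every denominator (\<open>Q_fun\<close>, \<open>e_fun\<close> and the differences of the
  \<open>t\<close>'s) is built from \<open>z\<close> and \<open>y\<close> alone and stays in the
  field \<open>F\<close>; \<open>lam\<close> occurs only in numerators. A ring \<open>T\<close>
  containing \<open>F\<close> and \<open>lam\<close> is therefore enough.\<close>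

lemma xi_fun_in:
  assumes "subring_set T" "subfield_set F" "F \<subseteq> T" "lam \<in> T" "y \<in> F"
    and z: "\<And>a. a \<in> {1..n} \<Longrightarrow> z a \<in> F" and I: "I \<subseteq> {1..n}"
  shows "xi_fun n I lam z y A \<in> T"
proof -
  interpret T: subring_set T by fact
  interpret F: subfield_set F by fact
  have fI: "finite I" using I by (rule finite_subset) simp
  define t where "t = (\<lambda>r. z (nth_elem I r))"
  have t: "t r \<in> F" if "r \<in> {1..card I}" for r
    unfolding t_def by (rule z) (use nth_elem_in[OF fI that] I in blast)
  have Q: "Q_fun n I z y \<in> F"
    unfolding Q_fun_def using I by (intro F.closed z assms) auto
  have e: "e_fun (card I) t y \<in> F"
    unfolding e_fun_def by (intro F.closed t assms)
  show ?thesis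
  proof (cases "A \<in> ksubsets n (card I)")
    case True
    then have A: "A \<subseteq> {1..n}" "card A = card I" by (auto simp: ksubsets_def)
    have FT: "a \<in> T" if "a \<in> F" for a using that assms(3) by blast
    have "W_fun n (rev_set n A) \<mu> t (\<lambda>i. z (n + 1 - i)) y \<in> T" if \<mu>: "\<mu> \<in> T" for \<mu>
    proof -
      have card: "card (rev_set n A) = card I" using card_rev_set[OF A(1)] A(2) by simp
      have z': "z (n + 1 - i) \<in> F" if "i \<in> {1..n}" for i using that by (intro z) auto
      have "(t (\<pi> a) - t (\<pi> b) + y) / (t (\<pi> a) - t (\<pi> b)) \<in> T"
        if "\<pi> permutes {1..card I}" "a \<in> {1..<b}" "b \<in> {1..card I}" for \<pi> a b
      proof -
        have "\<pi> a \<in> {1..card I}" "\<pi> b \<in> {1..card I}"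
          using permutes_in_image[OF that(1)] that(2,3) by auto
        then show ?thesis by (intro FT F.divide_in F.closed t assms)
      qed
      moreover have "l_factor n (rev_set n A) \<mu> (\<lambda>i. t (\<pi> i)) (\<lambda>i. z (n + 1 - i)) y r a \<in> T"
        if "\<pi> permutes {1..card I}" "r \<in> {1..card I}" "a \<in> {1..n}" for \<pi> r a
      proof -
        have "\<pi> r \<in> {1..card I}" using permutes_in_image[OF that(1)] that(2) by auto
        then have in_T: "t (\<pi> r) \<in> T" "z (n + 1 - a) \<in> T" "y \<in> T"
          using t z'[OF that(3)] \<open>y \<in> F\<close> FT by blast+
        have if_in: "(if c then u else v) \<in> T" if "u \<in> T" "v \<in> T" for c u v using that by simp
        show ?thesis unfolding l_factor_def by (intro if_in T.closed in_T \<mu>)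
      qed
      ultimately show ?thesis
        unfolding W_fun_def Let_def card using FT[OF \<open>y \<in> F\<close>] by (intro T.closed) auto
    qed
    moreover have "- lam - of_int (int n - 2 * int (card A)) * y \<in> T"
      by (intro T.closed assms FT)
    moreover have "1 / Q_fun n I z y \<in> T" "(- 1) ^ card A / e_fun (card A) t y \<in> T"
      unfolding A(2) by (intro FT F.divide_in F.closed Q e)+
    ultimately show ?thesis
      unfolding xi_fun_def if_P[OF True] W_minus_alt t_def[symmetric] by (intro T.mult_in)
  qed (simp add: xi_fun_def T.zero_in)
qed

lemma subring_polys_in: "subring_set (polys_in V)"
proof
  show "1 \<in> polys_in V" by (simp add: polys_in_def keys_one)
  fix p q assume pq: "p \<in> polys_in V" "q \<in> polys_in V"
  show "p + q \<in> polys_in V" using pq keys_add[of p q] by (fastforce simp: polys_in_def)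
  show "p * q \<in> polys_in V"
    unfolding polys_in_def
  proof (intro CollectI ballI)
    fix m assume "m \<in> Poly_Mapping.keys (p * q)"
    then obtain a b where "m = a + b" "a \<in> Poly_Mapping.keys p" "b \<in> Poly_Mapping.keys q"
      using keys_mult[of p q] by blast
    then show "Poly_Mapping.keys m \<subseteq> V"
      using pq keys_add[of a b] unfolding polys_in_def by blast
  qed
next
  fix p assume "p \<in> polys_in V"
  then show "- p \<in> polys_in V" by (simp add: polys_in_def in_keys_iff)
qed

definition zy_coeffs :: "nat \<Rightarrow> zy_field set" where
  "zy_coeffs n = {Fraction_Field.Fract p q | p q. p \<in> polys_in {0..n} \<and> q \<in> polys_in {0..n} \<and> q \<noteq> 0}"

lemma zy_coeffsI:
  "p \<in> polys_in {0..n} \<Longrightarrow> q \<in> polys_in {0..n} \<Longrightarrow> q \<noteq> 0 \<Longrightarrow> Fraction_Field.Fract p q \<in> zy_coeffs n"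
  unfolding zy_coeffs_def by blast

lemma C_zy_alt: "C_zy n = embed_zy ` zy_coeffs n"
  by (auto simp: C_zy_def zy_coeffs_def)

lemma subfield_zy_coeffs: "subfield_set (zy_coeffs n)"
proof -
  interpret P: subring_set "polys_in {0..n}" by (rule subring_polys_in)
  show ?thesis
  proof
    show "1 \<in> zy_coeffs n" unfolding One_fract_def by (intro zy_coeffsI P.one_in one_neq_zero)
    fix a b assume "a \<in> zy_coeffs n" "b \<in> zy_coeffs n"
    then obtain p q p' q' where a: "a = Fraction_Field.Fract p q" "p \<in> polys_in {0..n}" "q \<in> polys_in {0..n}" "q \<noteq> 0"
      and b: "b = Fraction_Field.Fract p' q'" "p' \<in> polys_in {0..n}" "q' \<in> polys_in {0..n}" "q' \<noteq> 0"
      unfolding zy_coeffs_def by blast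
    have "a + b = Fraction_Field.Fract (p * q' + p' * q) (q * q')" "a * b = Fraction_Field.Fract (p * p') (q * q')"
      using a b by simp_all
    moreover have "p * q' + p' * q \<in> polys_in {0..n}" "p * p' \<in> polys_in {0..n}" "q * q' \<in> polys_in {0..n}" "q * q' \<noteq> 0"
      using a b by (simp_all add: P.closed)
    ultimately show "a + b \<in> zy_coeffs n" "a * b \<in> zy_coeffs n" unfolding zy_coeffs_def by blast+
  next
    fix a assume "a \<in> zy_coeffs n"
    then obtain p q where a: "a = Fraction_Field.Fract p q" "p \<in> polys_in {0..n}" "q \<in> polys_in {0..n}" "q \<noteq> 0"
      unfolding zy_coeffs_def by blast
    then have "- a = Fraction_Field.Fract (- p) q" "- p \<in> polys_in {0..n}" by (simp_all add: P.closed)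
    then show "- a \<in> zy_coeffs n" unfolding zy_coeffs_def using a by blast
    show "inverse a \<in> zy_coeffs n"
    proof (cases "p = 0")
      case True
      then have "inverse a = Fraction_Field.Fract 0 1" using a by (simp add: Zero_fract_def[symmetric] fract_collapse)
      then show ?thesis by (simp only: zy_coeffsI P.zero_in P.one_in one_neq_zero not_False_eq_True)
    next
      case False
      then have "inverse a = Fraction_Field.Fract q p" using a by simp
      then show ?thesis unfolding zy_coeffs_def using a False by blast
    qed
  qed
qed

lemma subfield_C_zy: "subfield_set (C_zy n)"
proof -
  interpret K: subfield_set "zy_coeffs n" by (rule subfield_zy_coeffs)
  have inv: "inverse (embed_zy a) = embed_zy (inverse a)" for a
    using embed.hom_divide[of 1 a] by (simp add: embed.hom_one inverse_eq_divide)
  show ?thesis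
    unfolding C_zy_alt
  proof
    show "1 \<in> embed_zy ` zy_coeffs n" using K.one_in embed.hom_one by (metis imageI)
    show "inverse a \<in> embed_zy ` zy_coeffs n" if "a \<in> embed_zy ` zy_coeffs n" for a
      using that by (auto simp: inv K.inverse_in)
  qed (auto simp: embed.hom_add[symmetric] embed.hom_mult[symmetric] embed.hom_uminus[symmetric] K.closed)
qed

text \<open>The polynomials in \<open>\<lambda>\<close> over \<open>C_zy n\<close>. The coordinates
  already lie here, so only the inclusion in \<open>L_lam_zy n\<close> is needed and the latter need
  not be shown to be a ring.\<close>

definition lam_polys :: "nat \<Rightarrow> ratfun set" where
  "lam_polys n = {Fraction_Field.Fract p 1 | p. \<forall>i. coeff p i \<in> zy_coeffs n}"

lemma subring_lam_polys: "subring_set (lam_polys n)"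
proof -
  interpret K: subfield_set "zy_coeffs n" by (rule subfield_zy_coeffs)
  show ?thesis
  proof
    show "1 \<in> lam_polys n"
      unfolding lam_polys_def One_fract_def by (auto intro!: exI[of _ 1] simp: coeff_1 K.closed)
    fix a b assume "a \<in> lam_polys n" "b \<in> lam_polys n"
    then obtain p q where a: "a = Fraction_Field.Fract p 1" "\<And>i. coeff p i \<in> zy_coeffs n"
      and b: "b = Fraction_Field.Fract q 1" "\<And>i. coeff q i \<in> zy_coeffs n"
      unfolding lam_polys_def by blast
    have "a + b = Fraction_Field.Fract (p + q) 1" "a * b = Fraction_Field.Fract (p * q) 1" using a b by simp_all
    moreover have "coeff (p + q) i \<in> zy_coeffs n" "coeff (p * q) i \<in> zy_coeffs n" for i
      using a b by (auto simp: coeff_mult intro!: K.closed)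
    ultimately show "a + b \<in> lam_polys n" "a * b \<in> lam_polys n" unfolding lam_polys_def by blast+
  next
    fix a assume "a \<in> lam_polys n"
    then obtain p where a: "a = Fraction_Field.Fract p 1" "\<And>i. coeff p i \<in> zy_coeffs n"
      unfolding lam_polys_def by blast
    then have "- a = Fraction_Field.Fract (- p) 1" "\<And>i. coeff (- p) i \<in> zy_coeffs n" by (simp_all add: K.closed)
    then show "- a \<in> lam_polys n" unfolding lam_polys_def by blast
  qed
qed

text \<open>A power of \<open>\<lambda>\<close> lies in \<open>L_lam_y\<close> with the empty
  product as denominator, so the expansion by coefficients is a sum of the required
  products.\<close>

lemma lam_polys_subset: "lam_polys n \<subseteq> L_lam_zy n"
proof
  interpret P: subring_set "polys_in {0}" by (rule subring_polys_in)
  have lam_power: "Fraction_Field.Fract (monom 1 i) 1 \<in> L_lam_y" for i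
  proof -
    have "Fraction_Field.Fract (monom 1 i) 1 \<in> C_lam_y"
      unfolding C_lam_y_def
    proof (intro CollectI exI[of _ "monom 1 i"] conjI allI refl)
      fix j
      show "coeff (monom (1::zy_field) i) j \<in> (\<lambda>p. Fraction_Field.Fract p 1) ` polys_in {0}"
        using imageI[OF P.one_in, of "\<lambda>p. Fraction_Field.Fract p 1"] imageI[OF P.zero_in, of "\<lambda>p. Fraction_Field.Fract p 1"]
        by (simp add: One_fract_def[symmetric] Zero_fract_def[symmetric])
    qed
    moreover have "Fraction_Field.Fract (monom 1 i) 1 = Fraction_Field.Fract (monom 1 i) 1 / (\<Prod>l\<leftarrow>[]. lam_var + of_int l * y_var)"
      by simp
    ultimately show ?thesis unfolding L_lam_y_def by blast
  qed
  fix a assume "a \<in> lam_polys n"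
  then obtain p where a: "a = Fraction_Field.Fract p 1" "\<And>i. coeff p i \<in> zy_coeffs n"
    unfolding lam_polys_def by blast
  have Fract_sum: "Fraction_Field.Fract (sum f A) 1 = (\<Sum>x\<in>A. Fraction_Field.Fract (f x) 1)"
    for f :: "nat \<Rightarrow> zy_field poly" and A
  proof -
    have "Fraction_Field.Fract (a + b) 1 = Fraction_Field.Fract a 1 + Fraction_Field.Fract b 1" for a b :: "zy_field poly"
      by simp
    then show ?thesis
      by (induction A rule: infinite_finite_induct) (simp_all add: Zero_fract_def[symmetric] del: add_fract)
  qed
  have "a = (\<Sum>i<degree p + 1. Fraction_Field.Fract (monom (coeff p i) i) 1)"
    unfolding a(1) Fract_sum[symmetric] using poly_as_sum_of_monoms[of p]
    by (simp add: lessThan_Suc_atMost)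
  also have "\<dots> = (\<Sum>i<degree p + 1. Fraction_Field.Fract (monom 1 i) 1 * embed_zy (coeff p i))"
    by (simp add: embed_zy_def smult_monom)
  finally show "a \<in> L_lam_zy n"
    unfolding L_lam_zy_def using lam_power a(2) by (fastforce simp: C_zy_alt)
qed

lemma xi_in_V_tensor:
  assumes I: "I \<subseteq> {1..n}"
  shows "xi n I \<in> V_tensor n"
proof -
  interpret K: subfield_set "zy_coeffs n" by (rule subfield_zy_coeffs)
  have F: "C_zy n \<subseteq> lam_polys n"
  proof
    fix a assume "a \<in> C_zy n"
    then obtain c where c: "a = Fraction_Field.Fract [:c:] 1" "c \<in> zy_coeffs n"
      by (auto simp: C_zy_alt embed_zy_def)
    then have "coeff [:c:] i \<in> zy_coeffs n" for i by (cases i) (simp_all add: K.closed)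
    then show "a \<in> lam_polys n" unfolding lam_polys_def using c(1) by blast
  qed
  have var: "zy_var a \<in> zy_coeffs n" if "a \<le> n" for a
  proof -
    have "Poly_Mapping.single (Poly_Mapping.single a 1) 1 \<in> polys_in {0..n}" using that by (auto simp: polys_in_def)
    moreover have "1 \<in> polys_in {0..n}" by (rule subring_set.one_in[OF subring_polys_in])
    ultimately show ?thesis unfolding zy_var_def by (intro zy_coeffsI one_neq_zero)
  qed
  have "coeff [:0, 1:] i \<in> zy_coeffs n" for i
    by (auto simp: coeff_pCons K.closed split: nat.split)
  then have lam: "lam_var \<in> lam_polys n" unfolding lam_polys_def lam_var_def by blast
  have "xi n I A \<in> lam_polys n" for A
    unfolding xi_def
    by (rule xi_fun_in[OF subring_lam_polys subfield_C_zy F lam])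
      (use var I in \<open>auto simp: y_var_def z_var_def C_zy_alt\<close>)
  moreover have "xi n I A = 0" if "\<not> A \<subseteq> {1..n}" for A
    using that by (auto simp: xi_def xi_fun_def ksubsets_def)
  ultimately show ?thesis unfolding V_tensor_def using lam_polys_subset by blast
qed

theorem proposition9p5:
  fixes n k :: nat and I :: "nat set"
  assumes "1 \<le> n" and "k \<le> n" and "I \<in> ksubsets n k"
  shows "xi n I \<in> V_tensor n \<and>
         L22_tilde n (xi n I) =
           (\<lambda>J. (\<Prod>i\<in>I. (w_ser - z_ser i) / (w_ser - z_ser i - y_ser)) * fls_const (xi n I J))"
proof -
  have "I \<subseteq> {1..n}" using assms(3) by (simp add: ksubsets_def)
  then show ?thesis using xi_in_V_tensor L22_tilde_xi by blast
qed

end
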